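(* Consider the golf process on $\mathbb{Z}$ with parameters $\rho_b,\rho_h,p$ where $\rho_b+\rho_h=1$ and $\rho_b<\rho_h$, and let $\lambda=\rho_b\rho_h$. Then for every $R>0$ and every $(b_i)_{-R\le i\le R}\in\mathbb{N}^{2R+1}$, $$\mathbb{P}\left(\Delta_iH^1=2b_i,\ -R\le i\le R\right)=\frac{(2b_0+1)C_{b_0}\lambda^{b_0}}{\mathcal{H}(\lambda)}\prod_{i=-R,\,i\ne0}^{R}\frac{C_{b_i}\lambda^{b_i}}{\mathcal{G}(\lambda)},$$ where $C_k=\frac{1}{k+1}\binom{2k}{k}$, $\mathcal{G}(a)=\sum_{k\ge0}C_ka^k=\frac{1-\sqrt{1-4a}}{2a}$ and $\mathcal{H}(a)=\sum_{k\ge0}(2k+1)C_ka^k=2a\mathcal{G}'(a)+\mathcal{G}(a)$ for $a\in(0,1/4]$. In particular the $\Delta_iH^1$ are independent, $\mathbb{P}(\Delta_iH^1=2b)=C_b\lambda^b/\mathcal{G}(\lambda)$ for $i\ne0$, and $\mathbb{P}(\Delta_0H^1=2b)=(2b+1)C_b\lambda^b/\mathcal{H}(\lambda)$.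
   Context: Golf process on $\mathbb{Z}$: initial states i.i.d., ball with probability $\rho_b$, hole with probability $\rho_h$, neutral otherwise; clocks i.i.d. uniform on $[0,1]$; at its clock time each ball performs an independent random walk (step $+1$ w.p. $p$, $-1$ w.p. $1-p$) from its vertex, stopped at the first currently free hole, which it fills (this process is well defined almost surely when $\rho_b\le\rho_h$). $H^1$ denotes the set of holes still free at time $1$; under the hypotheses it is a.s. infinite in both directions. Index it increasingly as $(H^1_i)_{i\in\mathbb{Z}}$ where $H^1_0$ is the largest nonpositive element, and set $\Delta_iH^1=H^1_{i+1}-H^1_i-1$. *)

theory Defs
  imports "HOL-Probability.Probability"
begin

datatype site_state = Ball | Hole | Neutral

definition state_pmf :: "real \<Rightarrow> real \<Rightarrow> site_state pmf" where
  "state_pmf rb rh =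
     bind_pmf (bernoulli_pmf rb) (\<lambda>b. if b then return_pmf Ball
       else map_pmf (\<lambda>h. if h then Hole else Neutral) (bernoulli_pmf (rh / (1 - rb))))"

text \<open>Randomness attached to one vertex: initial state, clock (uniform on [0,1]),
  and the steps of its random walk (True = step +1, with probability p).\<close>
type_synonym site = "site_state \<times> real \<times> (nat \<Rightarrow> bool)"

definition site_measure :: "real \<Rightarrow> real \<Rightarrow> real \<Rightarrow> site measure" where
  "site_measure rb rh p =
     measure_pmf (state_pmf rb rh) \<Otimes>\<^sub>M
       (uniform_measure lborel {0..1::real} \<Otimes>\<^sub>M PiM UNIV (\<lambda>_::nat. measure_pmf (bernoulli_pmf p)))"

definition golf_space :: "real \<Rightarrow> real \<Rightarrow> real \<Rightarrow> (int \<Rightarrow> site) measure" where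
  "golf_space rb rh p = PiM UNIV (\<lambda>_::int. site_measure rb rh p)"

definition st :: "(int \<Rightarrow> site) \<Rightarrow> int \<Rightarrow> site_state" where
  "st \<omega> x = fst (\<omega> x)"

definition clock :: "(int \<Rightarrow> site) \<Rightarrow> int \<Rightarrow> real" where
  "clock \<omega> x = fst (snd (\<omega> x))"

definition walk_pos :: "(int \<Rightarrow> site) \<Rightarrow> int \<Rightarrow> nat \<Rightarrow> int" where
  "walk_pos \<omega> x k = x + (\<Sum>j<k. if snd (snd (\<omega> x)) j then 1 else -1)"

text \<open>The ball started at x moves along its walk and fills the first currently free hole
  (set F) it visits; if it never visits one, nothing changes.\<close>
definition ball_move :: "(int \<Rightarrow> site) \<Rightarrow> int \<Rightarrow> int set \<Rightarrow> int set" where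
  "ball_move \<omega> x F =
     (if \<exists>k. walk_pos \<omega> x k \<in> F
      then F - {walk_pos \<omega> x (LEAST k. walk_pos \<omega> x k \<in> F)} else F)"

text \<open>Finite-volume approximation: only the balls in [-n,n] (with clock \<le> 1) move,
  in increasing order of their clocks (stable sort: ties, of probability 0, broken by position);
  result: set of free holes at time 1.\<close>
definition free_holes_fin :: "(int \<Rightarrow> site) \<Rightarrow> nat \<Rightarrow> int set" where
  "free_holes_fin \<omega> n =
     fold (ball_move \<omega>)
       (sort_key (clock \<omega>)
          (filter (\<lambda>x. st \<omega> x = Ball \<and> clock \<omega> x \<le> 1) [- int n..int n]))
       {x. st \<omega> x = Hole}"

text \<open>H^1: free holes at time 1 for the process on Z, as the limit of the finite-volume processes.\<close>
definition H1 :: "(int \<Rightarrow> site) \<Rightarrow> int set" where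
  "H1 \<omega> = {x. \<forall>\<^sub>F n in sequentially. x \<in> free_holes_fin \<omega> n}"

text \<open>Increasing enumeration (S_i) of a set S of integers, S_0 = largest nonpositive element.\<close>
definition enum_idx :: "int set \<Rightarrow> int \<Rightarrow> int" where
  "enum_idx S i =
     (if i \<le> 0 then THE h. h \<in> S \<and> h \<le> 0 \<and> int (card {y\<in>S. h \<le> y \<and> y \<le> 0}) = 1 - i
      else THE h. h \<in> S \<and> 0 < h \<and> int (card {y\<in>S. 0 < y \<and> y \<le> h}) = i)"

definition gap :: "int set \<Rightarrow> int \<Rightarrow> int" where
  "gap S i = enum_idx S (i + 1) - enum_idx S i - 1"

definition catalan :: "nat \<Rightarrow> real" where
  "catalan k = real ((2 * k) choose k) / real (k + 1)"

definition Gfun :: "real \<Rightarrow> real" where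
  "Gfun a = (\<Sum>k. catalan k * a ^ k)"

definition Hfun :: "real \<Rightarrow> real" where
  "Hfun a = (\<Sum>k. real (2 * k + 1) * catalan k * a ^ k)"

end

theory Submission
  imports Defs
begin

text \<open>Adding a ball only removes free holes, so the finite-volume processes decrease to \<open>H1\<close>. If the points
  \<open>x\<^sub>0 < \<dots> < x\<^sub>m\<close> stay free, no ball crosses them; hence they stay free iff they are initial holes and the
  independent processes in the complementary intervals and half-lines are confined. The probability that
  consecutive free holes sit at prescribed points is therefore the density of free holes times one factor
  per gap.

  Lower bounds suffice for both kinds of factor. Counting holes minus balls in a large window gives density
  at least \<open>rh - rb\<close>. For a gap of length \<open>2b\<close>, run the process with \<open>b\<close> balls and \<open>b + 1\<close> holes on a cycle of
  length \<open>2b + 1\<close>: by rotation invariance the remaining hole is uniform, which yields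
  \<open>(2b+1 choose b) / (2b+1) = catalan b\<close> configurations, for every \<open>p\<close>. Since \<open>Gfun (rb * rh) = 1 / rh\<close> and
  \<open>Hfun (rb * rh) = 1 / (rh * (rh - rb))\<close>, these lower bounds add up to one over all gap sequences, so they are
  all equalities; in particular \<open>H1\<close> is almost surely infinite in both directions, and no junk value of
  \<^const>\<open>enum_idx\<close> contributes.\<close>

section \<open>Processes of trajectories and their localization\<close>

text \<open>A direct computation of the law would have to exclude odd gaps and a set
  \<open>H1\<close> that is bounded on one side; the mass count does both at once. The density
  enters because the half-lines beyond the outermost prescribed points have probabilities that are
  not known separately: only their product occurs, and it is the probability that one given vertex
  stays free. Each gap is taken together with the free hole at its left end, whence its weight
  \<open>catalan b * (rb * rh) ^ b * rh\<close>; the last factor is that hole, and it is also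
  \<open>1 / Gfun (rb * rh)\<close>. The gap of index 0 is size-biased because its left end can be
  any of the \<open>2 * b 0 + 1\<close> integers from \<open>- 2 * b 0\<close> to 0, and the density
  \<open>rh - rb\<close> is absorbed into its normalization. What makes the factors independent is
  the choice of the local processes: a ball that leaves its interval is stopped there, so each
  factor is an event about its own coordinates.\<close>

definition hits :: "(nat \<Rightarrow> int) \<Rightarrow> int set \<Rightarrow> nat \<Rightarrow> bool" where
  "hits w F k \<longleftrightarrow> w k \<in> F \<and> (\<forall>j<k. w j \<notin> F)"

text \<open>The removed set has at most one element, by \<open>hits_unique\<close>, and is empty if
  the trajectory never meets \<open>F\<close>. This form needs neither \<open>LEAST\<close> nor a
  case distinction, which suits monotonicity and measurability.\<close>

definition fill :: "(nat \<Rightarrow> int) \<Rightarrow> int set \<Rightarrow> int set" where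
  "fill w F = F - {y. \<exists>k. hits w F k \<and> w k = y}"

text \<open>The trajectories are a parameter, so that the same lemmas apply to the walks on the line
  and to their reductions on a cycle.\<close>

definition proc :: "('a \<Rightarrow> nat \<Rightarrow> int) \<Rightarrow> 'a list \<Rightarrow> int set \<Rightarrow> int set" where
  "proc w L F = fold (\<lambda>x. fill (w x)) L F"

lemma proc_Nil [simp]: "proc w [] F = F"
  and proc_Cons [simp]: "proc w (x # L) F = proc w L (fill (w x) F)"
  by (simp_all add: proc_def)

lemma hits_unique: "hits w F k \<Longrightarrow> hits w F k' \<Longrightarrow> k = k'"
  unfolding hits_def by (metis linorder_neqE_nat)

lemma hits_exists: "w k \<in> F \<Longrightarrow> \<exists>j\<le>k. hits w F j"
  unfolding hits_def
  by (rule exI[of _ "LEAST k. w k \<in> F"]) (auto intro: LeastI Least_le dest: not_less_Least)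

lemma ball_move_eq_fill: "ball_move \<omega> x F = fill (walk_pos \<omega> x) F"
proof (cases "\<exists>k. walk_pos \<omega> x k \<in> F")
  case True
  let ?k = "LEAST k. walk_pos \<omega> x k \<in> F"
  have "hits (walk_pos \<omega> x) F ?k"
    unfolding hits_def using True LeastI_ex[of "\<lambda>k. walk_pos \<omega> x k \<in> F"] not_less_Least by blast
  hence "{y. \<exists>k. hits (walk_pos \<omega> x) F k \<and> walk_pos \<omega> x k = y} = {walk_pos \<omega> x ?k}"
    using hits_unique[of "walk_pos \<omega> x" F] by blast
  then show ?thesis using True by (simp add: ball_move_def fill_def)
next
  case False
  then show ?thesis by (auto simp: ball_move_def fill_def hits_def)
qed

lemma fill_subset: "fill w F \<subseteq> F"
  by (auto simp: fill_def)

text \<open>If the first point of the larger set that is visited lies in the smaller set, it is also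
  the first visited point of the smaller set.\<close>

lemma fill_mono: "F' \<subseteq> F \<Longrightarrow> fill w F' \<subseteq> fill w F"
  unfolding fill_def hits_def by blast

lemma proc_subset: "proc w L F \<subseteq> F"
proof (induction L arbitrary: F)
  case (Cons x L)
  then show ?case using fill_subset by (metis proc_Cons order_trans)
qed simp

lemma proc_mono: "F' \<subseteq> F \<Longrightarrow> proc w L F' \<subseteq> proc w L F"
  by (induction L arbitrary: F F') (auto dest: fill_mono)

text \<open>Skipping a ball leaves a larger set of holes, and by \<open>proc_mono\<close> the later
  balls keep this inclusion.\<close>

lemma proc_filter: "proc w L F \<subseteq> proc w (filter P L) F"
proof (induction L arbitrary: F)
  case (Cons x L)
  have "proc w L (fill (w x) F) \<subseteq> proc w L F" by (simp add: proc_mono fill_subset)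
  then show ?case using Cons[of F] Cons[of "fill (w x) F"] by auto
qed auto

lemma proc_cong:
  "(\<And>x. x \<in> set L \<Longrightarrow> w x = w' x) \<Longrightarrow> proc w L F = proc w' L F"
  by (induction L arbitrary: F) auto

lemma hits_inj: "inj g \<Longrightarrow> hits (\<lambda>k. g (w k)) (g ` F) k \<longleftrightarrow> hits w F k"
  by (simp add: hits_def inj_image_mem_iff)

lemma fill_inj: "inj g \<Longrightarrow> fill (\<lambda>k. g (w k)) (g ` F) = g ` fill w F"
  unfolding fill_def by (subst image_set_diff) (auto simp: hits_inj dest: injD)

text \<open>Used for translations of the line in \<open>loc_shift\<close> and for rotations of a
  cycle in \<open>cyc_rot\<close>. Injectivity on all integers keeps the first visited hole the same
  on both sides.\<close>

lemma proc_inj: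
  assumes "inj g" "\<And>x k. x \<in> set L \<Longrightarrow> w' (h x) k = g (w x k)"
  shows "proc w' (map h L) (g ` F) = g ` proc w L F"
  using assms(2)
proof (induction L arbitrary: F)
  case (Cons x L)
  have "w' (h x) = (\<lambda>k. g (w x k))" using Cons.prems by auto
  then show ?case using Cons by (simp add: fill_inj[OF assms(1)])
qed simp

lemma fill_eq: "hits w F k \<Longrightarrow> fill w F = F - {w k}"
  unfolding fill_def using hits_unique by blast

lemma fill_cases:
  obtains "fill w F = F" | k where "hits w F k" "fill w F = F - {w k}"
proof (cases "\<exists>k. hits w F k")
  case True
  then obtain k where k: "hits w F k" by blast
  then show ?thesis using that fill_eq by blast
next
  case False
  then show ?thesis using that by (simp add: fill_def)
qed

lemma card_proc_ge:
  assumes "finite A"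
  shows "card (F \<inter> A) \<le> card (proc w L F \<inter> A) + length L"
proof (induction L arbitrary: F)
  case (Cons x L)
  have "card (F \<inter> A) \<le> Suc (card (fill (w x) F \<inter> A))"
  proof (cases rule: fill_cases[of "w x" F])
    case 1
    then show ?thesis by simp
  next
    case (2 k)
    have "card (F \<inter> A) \<le> Suc (card ((F \<inter> A) - {w x k}))"
    proof (cases "w x k \<in> F \<inter> A")
      case True
      then show ?thesis using card_Suc_Diff1[OF finite_Int[OF disjI2[OF assms]] True] by linarith
    next
      case False
      then show ?thesis by (metis Diff_insert0 Diff_empty le_SucI order_refl)
    qed
    moreover have "(F \<inter> A) - {w x k} = fill (w x) F \<inter> A" using 2 by auto
    ultimately show ?thesis by simp
  qed
  then show ?case using Cons[of "fill (w x) F"] by simp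
qed simp

text \<open>Every ball leaves \<open>I\<close> at some time and everything outside \<open>I\<close>
  is a free hole, so the ball does fill a hole; as the outside is intact at the end, that hole lies
  in \<open>I\<close>. Each ball therefore removes exactly one point of \<open>I\<close>.\<close>

lemma card_proc_eq:
  assumes "finite I" "\<And>x. x \<in> set L \<Longrightarrow> \<exists>k. w x k \<notin> I" "- I \<subseteq> proc w L F"
  shows "card (proc w L F \<inter> I) + length L = card (F \<inter> I)"
  using assms(2,3)
proof (induction L arbitrary: F)
  case (Cons x L)
  have sub: "- I \<subseteq> fill (w x) F" using Cons.prems(2) proc_subset[of w L "fill (w x) F"] by simp
  obtain k0 where "w x k0 \<notin> I" using Cons.prems(1) by auto
  hence "w x k0 \<in> F" using sub fill_subset by blast
  then obtain k where k: "hits (w x) F k" using hits_exists by blast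
  hence eq: "fill (w x) F = F - {w x k}" by (rule fill_eq)
  have "w x k \<in> F \<inter> I" using k eq sub by (auto simp: hits_def)
  moreover have "fill (w x) F \<inter> I = (F \<inter> I) - {w x k}" using eq by auto
  ultimately have "card (fill (w x) F \<inter> I) + 1 = card (F \<inter> I)"
    using card_Suc_Diff1[of "F \<inter> I" "w x k"] assms(1) by (metis Suc_eq_plus1 finite_Int)
  then show ?case using Cons.IH[of "fill (w x) F"] Cons.prems sub by simp
qed simp

text \<open>Here \<open>w\<close> is a trajectory of the ambient process, which may live on a cycle, and \<open>v\<close> the corresponding
  trajectory on the line; they agree until \<open>v\<close> leaves \<open>I\<close>, and at that time \<open>w\<close> is in the separating set \<open>X\<close>.\<close>
definition exits_via :: "(nat \<Rightarrow> int) \<Rightarrow> (nat \<Rightarrow> int) \<Rightarrow> int set \<Rightarrow> int set \<Rightarrow> bool" where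
  "exits_via w v I X \<longleftrightarrow> (\<forall>k. (\<forall>j<k. w j = v j \<and> v j \<in> I) \<longrightarrow>
     (w k = v k \<and> v k \<in> I) \<or> (w k \<in> X \<and> v k \<notin> I))"

text \<open>Since \<open>X\<close> consists of free holes and the local process regards all of
  \<open>- I\<close> as holes, both trajectories are stopped at the moment of leaving
  \<open>I\<close>, hence at the same time.\<close>

lemma hits_local:
  assumes ex: "exits_via w v I X" and X: "X \<subseteq> F"
  shows "hits w F k \<longleftrightarrow> hits v (F \<inter> I \<union> - I) k"
    and "hits w F k \<Longrightarrow> (w k = v k \<and> v k \<in> I) \<or> (w k \<in> X \<and> v k \<notin> I)"
proof -
  have C: "(w k = v k \<and> v k \<in> I) \<or> (w k \<in> X \<and> v k \<notin> I)"
    if "\<forall>j<k. w j = v j \<and> v j \<in> I" for k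
    by (rule ex[unfolded exits_via_def, THEN spec, THEN mp, OF that])
  \<comment> \<open>As long as \<open>w\<close> avoids \<open>F\<close> it avoids \<open>X\<close>,
    so it has not left \<open>I\<close> and still agrees with \<open>v\<close>.\<close>
  have A: "\<forall>j<k. w j = v j \<and> v j \<in> I" if "\<forall>j<k. w j \<notin> F" for k
    using that
  proof (induction k)
    case (Suc k)
    have "\<forall>j<k. w j \<notin> F" using Suc.prems less_Suc_eq by blast
    note IH = Suc.IH[OF this]
    have "w k \<notin> X" using Suc.prems X by blast
    hence "w k = v k \<and> v k \<in> I" using C[OF IH] by blast
    thus ?case using IH less_Suc_eq by blast
  qed simp
  \<comment> \<open>The same from the side of \<open>v\<close>: before meeting \<open>- I\<close> it
    stays in \<open>I\<close>.\<close>
  have B: "\<forall>j<k. w j = v j \<and> v j \<in> I" if "\<forall>j<k. v j \<notin> F \<inter> I \<union> - I" for k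
    using that
  proof (induction k)
    case (Suc k)
    have "\<forall>j<k. v j \<notin> F \<inter> I \<union> - I" using Suc.prems less_Suc_eq by blast
    note IH = Suc.IH[OF this]
    have "v k \<in> I" using Suc.prems by blast
    hence "w k = v k \<and> v k \<in> I" using C[OF IH] by blast
    thus ?case using IH less_Suc_eq by blast
  qed simp
  show "(w k = v k \<and> v k \<in> I) \<or> (w k \<in> X \<and> v k \<notin> I)" if "hits w F k"
    by (rule C[OF A]) (use that in \<open>simp add: hits_def\<close>)
  show "hits w F k \<longleftrightarrow> hits v (F \<inter> I \<union> - I) k"
  proof
    assume h: "hits w F k"
    have a: "\<forall>j<k. w j = v j \<and> v j \<in> I" by (rule A) (use h in \<open>simp add: hits_def\<close>)
    then show "hits v (F \<inter> I \<union> - I) k" using C[OF a] h unfolding hits_def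
      by (metis ComplI IntI UnE UnI1 UnI2 IntD1 ComplD)
  next
    assume h: "hits v (F \<inter> I \<union> - I) k"
    have b: "\<forall>j<k. w j = v j \<and> v j \<in> I" by (rule B) (use h in \<open>auto simp: hits_def\<close>)
    then show "hits w F k" using C[OF b] h X unfolding hits_def
      by (metis ComplI IntI UnE UnI1 UnI2 IntD1 ComplD subsetD)
  qed
qed

text \<open>A single ball either fills the same point of \<open>I\<close> in both processes, or
  fills a point of \<open>X\<close> in the ambient one and a point of \<open>- I\<close> in the
  local one. Survival of \<open>X\<close> can thus be read off locally, and if \<open>X\<close>
  survives the ball changes nothing in sets disjoint from \<open>I\<close>.\<close>

lemma fill_local:
  assumes ex: "exits_via w v I X" and X: "X \<subseteq> F" and XI: "X \<inter> I = {}"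
  shows "X \<subseteq> fill w F \<longleftrightarrow> - I \<subseteq> fill v (F \<inter> I \<union> - I)"
    and "X \<subseteq> fill w F \<Longrightarrow> fill v (F \<inter> I \<union> - I) = fill w F \<inter> I \<union> - I"
    and "X \<subseteq> fill w F \<Longrightarrow> I' \<inter> I = {} \<Longrightarrow> fill w F \<inter> I' = F \<inter> I'"
proof -
  note h = hits_local[OF ex X]
  have w: "X \<subseteq> fill w F \<longleftrightarrow> (\<forall>k. hits w F k \<longrightarrow> w k \<notin> X)"
    using X by (auto simp: fill_def)
  have v: "- I \<subseteq> fill v (F \<inter> I \<union> - I) \<longleftrightarrow> (\<forall>k. hits w F k \<longrightarrow> v k \<in> I)"
    by (auto simp: fill_def h(1))
  have *: "w k = v k \<and> v k \<in> I" if "hits w F k" "X \<subseteq> fill w F" for k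
    using h(2)[OF that(1)] that w by simp
  show "X \<subseteq> fill w F \<longleftrightarrow> - I \<subseteq> fill v (F \<inter> I \<union> - I)"
    unfolding w v using h(2) XI by (metis disjoint_iff)
  show "fill v (F \<inter> I \<union> - I) = fill w F \<inter> I \<union> - I" if "X \<subseteq> fill w F"
  proof (cases rule: fill_cases[of w F])
    case 1
    hence "\<not> hits w F k" for k by (auto simp: fill_def hits_def)
    then show ?thesis unfolding fill_def h(1)[symmetric] by simp
  next
    case (2 k)
    hence "fill v (F \<inter> I \<union> - I) = F \<inter> I \<union> - I - {v k}"
      using h(1) fill_eq by blast
    then show ?thesis using 2 *[OF 2(1) that] by auto
  qed
  show "fill w F \<inter> I' = F \<inter> I'" if "X \<subseteq> fill w F" "I' \<inter> I = {}"
  proof (cases rule: fill_cases[of w F])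
    case (2 k)
    then show ?thesis using *[OF 2(1) that(1)] that(2) by auto
  qed simp
qed

text \<open>Induction on the balls. While \<open>X\<close> is intact, a ball acts only in the member
  of the family in which it starts; the first ball to damage \<open>X\<close> also damages the
  outside of its own local process, and neither damage is ever repaired.\<close>

lemma proc_local:
  fixes w v :: "int \<Rightarrow> nat \<Rightarrow> int"
  assumes "X \<subseteq> F" "disjoint \<I>" "\<And>I. I \<in> \<I> \<Longrightarrow> X \<inter> I = {}"
    and "\<And>x. x \<in> set L \<Longrightarrow> \<exists>I\<in>\<I>. x \<in> I \<and> exits_via (w x) (v x) I X"
  shows "(X \<subseteq> proc w L F \<longleftrightarrow> (\<forall>I\<in>\<I>. - I \<subseteq> proc v (filter (\<lambda>x. x \<in> I) L) (F \<inter> I \<union> - I)))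
    \<and> (X \<subseteq> proc w L F \<longrightarrow>
        (\<forall>I\<in>\<I>. proc v (filter (\<lambda>x. x \<in> I) L) (F \<inter> I \<union> - I) = proc w L F \<inter> I \<union> - I))"
  using assms(1,4)
proof (induction L arbitrary: F)
  case (Cons x L)
  obtain I0 where I0: "I0 \<in> \<I>" "x \<in> I0" "exits_via (w x) (v x) I0 X" using Cons.prems by auto
  note loc = fill_local[OF I0(3) Cons.prems(1) assms(3)[OF I0(1)]]
  have disj: "I \<inter> I0 = {}" if "I \<in> \<I>" "I \<noteq> I0" for I
    using assms(2) that I0(1) unfolding disjoint_def by blast
  show ?case
  proof (cases "X \<subseteq> fill (w x) F")
    case True
    have IH: "(X \<subseteq> proc w L (fill (w x) F) \<longleftrightarrow>
          (\<forall>I\<in>\<I>. - I \<subseteq> proc v (filter (\<lambda>x. x \<in> I) L) (fill (w x) F \<inter> I \<union> - I)))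
        \<and> (X \<subseteq> proc w L (fill (w x) F) \<longrightarrow> (\<forall>I\<in>\<I>. proc v (filter (\<lambda>x. x \<in> I) L)
              (fill (w x) F \<inter> I \<union> - I) = proc w L (fill (w x) F) \<inter> I \<union> - I))"
      using True Cons.prems(2) by (intro Cons.IH) auto
    have "proc v (filter (\<lambda>x. x \<in> I) (x # L)) (F \<inter> I \<union> - I)
        = proc v (filter (\<lambda>x. x \<in> I) L) (fill (w x) F \<inter> I \<union> - I)" if "I \<in> \<I>" for I
    proof (cases "I = I0")
      case True
      then show ?thesis using loc(2)[OF \<open>X \<subseteq> fill (w x) F\<close>] I0(2) by simp
    next
      case False
      then show ?thesis using loc(3)[OF True] disj[OF that False] I0(2) by auto
    qed
    then show ?thesis using IH by simp
  next
    case False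
    hence "\<not> X \<subseteq> proc w (x # L) F" using proc_subset by fastforce
    moreover have "\<not> - I0 \<subseteq> proc v (filter (\<lambda>x. x \<in> I0) (x # L)) (F \<inter> I0 \<union> - I0)"
      using False loc(1) I0(2) proc_subset by fastforce
    ultimately show ?thesis using I0(1) by blast
  qed
qed simp

section \<open>The golf process restricted to a set of vertices\<close>

lemma walk_pos_0 [simp]: "walk_pos \<omega> x 0 = x"
  by (simp add: walk_pos_def)

lemma walk_pos_Suc: "walk_pos \<omega> x (Suc k) = walk_pos \<omega> x k + 1 \<or> walk_pos \<omega> x (Suc k) = walk_pos \<omega> x k - 1"
  by (simp add: walk_pos_def)

lemma exits_via_walk:
  assumes "x \<in> I" "X \<inter> I = {}" "\<And>y. y \<in> I \<Longrightarrow> y + 1 \<in> I \<union> X \<and> y - 1 \<in> I \<union> X"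
  shows "exits_via (walk_pos \<omega> x) (walk_pos \<omega> x) I X"
  unfolding exits_via_def
proof (intro allI impI)
  fix k assume *: "\<forall>j<k. walk_pos \<omega> x j = walk_pos \<omega> x j \<and> walk_pos \<omega> x j \<in> I"
  have "walk_pos \<omega> x k \<in> I \<union> X"
  proof (cases k)
    case (Suc m)
    then show ?thesis using * assms(3)[of "walk_pos \<omega> x m"] walk_pos_Suc[of \<omega> x m] by fastforce
  qed (use assms(1) in simp)
  then show "walk_pos \<omega> x k = walk_pos \<omega> x k \<and> walk_pos \<omega> x k \<in> I \<or> walk_pos \<omega> x k \<in> X \<and> walk_pos \<omega> x k \<notin> I"
    using assms(2) by blast
qed

definition active :: "(int \<Rightarrow> site) \<Rightarrow> int \<Rightarrow> bool" where
  "active \<omega> x \<longleftrightarrow> st \<omega> x = Ball \<and> clock \<omega> x \<le> 1"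

text \<open>A stable sort of the increasing list reproduces the tie-breaking of
  \<open>free_holes_fin\<close>, so that the identification with \<open>loc\<close> holds for every
  configuration.\<close>

definition order_of :: "(int \<Rightarrow> site) \<Rightarrow> int set \<Rightarrow> int list" where
  "order_of \<omega> A = sort_key (clock \<omega>) (filter (active \<omega>) (sorted_list_of_set A))"

text \<open>The process in \<open>I\<close> driven by the balls of \<open>A\<close>: outside \<open>I\<close> every vertex is a hole, so that a ball
  leaving \<open>I\<close> is absorbed at once and the process depends only on the randomness in \<open>I\<close>.\<close>
definition loc :: "(int \<Rightarrow> site) \<Rightarrow> int set \<Rightarrow> int set \<Rightarrow> int set" where
  "loc \<omega> I A = proc (walk_pos \<omega>) (order_of \<omega> (A \<inter> I)) ({x. st \<omega> x = Hole} \<inter> I \<union> - I)"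

text \<open>For infinite \<open>I\<close> the process is only available through finite sets of
  balls; the condition says that no such set makes a ball end outside \<open>I\<close>.\<close>

definition confined :: "(int \<Rightarrow> site) \<Rightarrow> int set \<Rightarrow> bool" where
  "confined \<omega> I \<longleftrightarrow> (\<forall>A. finite A \<longrightarrow> - I \<subseteq> loc \<omega> I A)"

lemma free_holes_fin_eq_loc: "free_holes_fin \<omega> n = loc \<omega> UNIV {- int n..int n}"
proof -
  have "ball_move \<omega> = (\<lambda>x. fill (walk_pos \<omega> x))" by (intro ext) (rule ball_move_eq_fill)
  then show ?thesis
    by (simp add: free_holes_fin_def loc_def proc_def order_of_def active_def[abs_def])
qed

lemma filter_sorted_list:
  fixes A :: "int set"
  assumes "finite A" shows "filter (\<lambda>x. x \<in> B) (sorted_list_of_set A) = sorted_list_of_set (A \<inter> B)"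
  by (rule sorted_distinct_set_unique) (use assms in \<open>auto simp: sorted_filter[of "\<lambda>x. x", simplified]\<close>)

lemma filter_order_of:
  "finite A \<Longrightarrow> filter (\<lambda>x. x \<in> B) (order_of \<omega> A) = order_of \<omega> (A \<inter> B)"
  by (simp add: order_of_def filter_sort filter_sorted_list[symmetric] conj_commute)

lemma set_order_of: "finite A \<Longrightarrow> set (order_of \<omega> A) = {x \<in> A. active \<omega> x}"
  by (simp add: order_of_def)

lemma length_order_of: "finite A \<Longrightarrow> length (order_of \<omega> A) = card {x \<in> A. active \<omega> x}"
  unfolding set_order_of[symmetric] by (rule distinct_card[symmetric]) (simp add: order_of_def)

lemma loc_antimono: "A \<subseteq> B \<Longrightarrow> finite B \<Longrightarrow> loc \<omega> I B \<subseteq> loc \<omega> I A"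
proof -
  assume "A \<subseteq> B" "finite B"
  hence "filter (\<lambda>x. x \<in> A) (order_of \<omega> (B \<inter> I)) = order_of \<omega> (A \<inter> I)"
    using filter_order_of[of "B \<inter> I" A \<omega>] by (metis finite_Int Int_assoc Int_commute inf.absorb_iff1)
  then show ?thesis unfolding loc_def by (metis proc_filter)
qed

text \<open>Additional balls leave fewer holes, and every finite set of balls lies in a large
  window, so "for all large windows" turns into "for all finite sets". This is the quantifier that
  also occurs in \<open>confined\<close>.\<close>

lemma H1_iff: "x \<in> H1 \<omega> \<longleftrightarrow> (\<forall>A. finite A \<longrightarrow> x \<in> loc \<omega> UNIV A)"
proof
  assume H: "x \<in> H1 \<omega>"
  show "\<forall>A. finite A \<longrightarrow> x \<in> loc \<omega> UNIV A"
  proof (intro allI impI)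
    fix A :: "int set" assume A: "finite A"
    obtain N where N: "\<And>n. n \<ge> N \<Longrightarrow> x \<in> loc \<omega> UNIV {- int n..int n}"
      using H unfolding H1_def eventually_sequentially free_holes_fin_eq_loc by auto
    define n where "n = Max (insert N ((\<lambda>y. nat \<bar>y\<bar>) ` A))"
    have "n \<ge> N" "\<And>y. y \<in> A \<Longrightarrow> nat \<bar>y\<bar> \<le> n" using A by (auto simp: n_def)
    hence "A \<subseteq> {- int n..int n}" by force
    then show "x \<in> loc \<omega> UNIV A" using N[OF \<open>n \<ge> N\<close>] loc_antimono by blast
  qed
qed (auto simp: H1_def free_holes_fin_eq_loc)

lemma H1_iff_nat: "x \<in> H1 \<omega> \<longleftrightarrow> (\<forall>n. x \<in> loc \<omega> UNIV {- int n..int n})"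
proof
  assume H: "\<forall>n. x \<in> loc \<omega> UNIV {- int n..int n}"
  then show "x \<in> H1 \<omega>" by (auto simp: H1_def free_holes_fin_eq_loc)
qed (simp add: H1_iff)

lemma order_of_cong:
  assumes "\<And>x. x \<in> I \<Longrightarrow> \<omega> x = \<omega>' x" "finite A" "A \<subseteq> I"
  shows "order_of \<omega> A = order_of \<omega>' A"
proof -
  have ins: "insort_key f x xs = insort_key g x xs"
    if "\<And>y. y \<in> insert x (set xs) \<Longrightarrow> f y = g y" for f g :: "int \<Rightarrow> real" and x xs
    using that by (induction xs) auto
  have srt: "sort_key f xs = sort_key g xs" if "\<And>y. y \<in> set xs \<Longrightarrow> f y = g y"
    for f g :: "int \<Rightarrow> real" and xs
    using that by (induction xs) (auto intro!: ins)
  have "filter (active \<omega>) (sorted_list_of_set A) = filter (active \<omega>') (sorted_list_of_set A)"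
    using assms by (intro filter_cong) (auto simp: active_def st_def clock_def)
  then show ?thesis unfolding order_of_def using assms by (auto intro!: srt simp: clock_def)
qed

lemma loc_cong:
  assumes "\<And>x. x \<in> I \<Longrightarrow> \<omega> x = \<omega>' x" "finite A"
  shows "loc \<omega> I A = loc \<omega>' I A"
proof -
  have "order_of \<omega> (A \<inter> I) = order_of \<omega>' (A \<inter> I)" by (rule order_of_cong[OF assms(1)]) (use assms in auto)
  moreover have "{x. st \<omega> x = Hole} \<inter> I = {x. st \<omega>' x = Hole} \<inter> I" using assms by (auto simp: st_def)
  ultimately show ?thesis unfolding loc_def
    by (auto intro!: proc_cong simp: set_order_of assms walk_pos_def)
qed

lemma confined_cong: "(\<And>x. x \<in> I \<Longrightarrow> \<omega> x = \<omega>' x) \<Longrightarrow> confined \<omega> I \<longleftrightarrow> confined \<omega>' I"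
  unfolding confined_def using loc_cong[of I \<omega> \<omega>'] by auto

lemma confined_finite:
  assumes "finite I" shows "confined \<omega> I \<longleftrightarrow> - I \<subseteq> loc \<omega> I I"
proof
  assume H: "- I \<subseteq> loc \<omega> I I"
  have U: "loc \<omega> I (A \<union> I) = loc \<omega> I I" for A unfolding loc_def by (simp add: Int_absorb1 Int_Un_distrib2)
  then show "confined \<omega> I" unfolding confined_def
  proof (intro allI impI)
    fix A :: "int set" assume "finite A"
    then show "- I \<subseteq> loc \<omega> I A"
      using H U[of A] loc_antimono[of A "A \<union> I" \<omega> I] assms by auto
  qed
qed (use assms in \<open>simp add: confined_def\<close>)

lemma loc_UNIV: "loc \<omega> UNIV A = proc (walk_pos \<omega>) (order_of \<omega> A) {x. st \<omega> x = Hole}"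
  by (simp add: loc_def)

lemma loc_decompose:
  assumes "X \<subseteq> {x. st \<omega> x = Hole}" "disjoint \<I>" "\<Union>\<I> = - X"
    and nb: "\<And>I y. I \<in> \<I> \<Longrightarrow> y \<in> I \<Longrightarrow> y + 1 \<in> I \<union> X \<and> y - 1 \<in> I \<union> X"
    and "finite A"
  shows "X \<subseteq> loc \<omega> UNIV A \<longleftrightarrow> (\<forall>I\<in>\<I>. - I \<subseteq> loc \<omega> I A)"
    and "X \<subseteq> loc \<omega> UNIV A \<Longrightarrow> I \<in> \<I> \<Longrightarrow> loc \<omega> I A = loc \<omega> UNIV A \<inter> I \<union> - I"
proof -
  have "\<exists>I\<in>\<I>. x \<in> I \<and> exits_via (walk_pos \<omega> x) (walk_pos \<omega> x) I X" if "x \<in> set (order_of \<omega> A)" for x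
  proof -
    have "x \<notin> X" using that assms(1) by (auto simp: set_order_of[OF \<open>finite A\<close>] active_def)
    then obtain I where I: "I \<in> \<I>" "x \<in> I" using assms(3) by blast
    have "X \<inter> I = {}" using I assms(3) by blast
    then have "exits_via (walk_pos \<omega> x) (walk_pos \<omega> x) I X"
      using I nb by (intro exits_via_walk)
    then show ?thesis using I by blast
  qed
  moreover have "X \<inter> I = {}" if "I \<in> \<I>" for I using that assms(3) by blast
  ultimately have *: "(X \<subseteq> loc \<omega> UNIV A \<longleftrightarrow> (\<forall>I\<in>\<I>. - I \<subseteq> loc \<omega> I A))
    \<and> (X \<subseteq> loc \<omega> UNIV A \<longrightarrow> (\<forall>I\<in>\<I>. loc \<omega> I A = loc \<omega> UNIV A \<inter> I \<union> - I))"
    using proc_local[OF assms(1,2), of "order_of \<omega> A" "walk_pos \<omega>" "walk_pos \<omega>"]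
    unfolding filter_order_of[OF \<open>finite A\<close>] loc_UNIV[symmetric] loc_def[symmetric] by blast
  show "X \<subseteq> loc \<omega> UNIV A \<longleftrightarrow> (\<forall>I\<in>\<I>. - I \<subseteq> loc \<omega> I A)"
    using * by blast
  show "loc \<omega> I A = loc \<omega> UNIV A \<inter> I \<union> - I" if "X \<subseteq> loc \<omega> UNIV A" "I \<in> \<I>"
    using * that by blast
qed

lemma H1_subset_holes: "H1 \<omega> \<subseteq> {x. st \<omega> x = Hole}"
proof
  fix x assume "x \<in> H1 \<omega>"
  hence "x \<in> loc \<omega> UNIV {}" unfolding H1_iff by blast
  then show "x \<in> {x. st \<omega> x = Hole}" by (simp add: loc_UNIV order_of_def)
qed

text \<open>The equivalence holds for each finite set of balls separately, and both sides quantify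
  over all of them; no limits have to be interchanged.\<close>

lemma H1_decompose:
  assumes "disjoint \<I>" "\<Union>\<I> = - X"
    and nb: "\<And>I y. I \<in> \<I> \<Longrightarrow> y \<in> I \<Longrightarrow> y + 1 \<in> I \<union> X \<and> y - 1 \<in> I \<union> X"
  shows "X \<subseteq> H1 \<omega> \<longleftrightarrow> X \<subseteq> {x. st \<omega> x = Hole} \<and> (\<forall>I\<in>\<I>. confined \<omega> I)"
proof -
  have "X \<subseteq> H1 \<omega> \<longleftrightarrow> (\<forall>I\<in>\<I>. confined \<omega> I)" if X: "X \<subseteq> {x. st \<omega> x = Hole}"
  proof -
    have "X \<subseteq> H1 \<omega> \<longleftrightarrow> (\<forall>A. finite A \<longrightarrow> X \<subseteq> loc \<omega> UNIV A)"
      unfolding subset_eq H1_iff by blast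
    also have "\<dots> \<longleftrightarrow> (\<forall>A. finite A \<longrightarrow> (\<forall>I\<in>\<I>. - I \<subseteq> loc \<omega> I A))"
      using loc_decompose(1)[OF X assms] by (intro all_cong1 imp_cong refl) auto
    also have "\<dots> \<longleftrightarrow> (\<forall>I\<in>\<I>. confined \<omega> I)"
      unfolding confined_def by blast
    finally show ?thesis .
  qed
  then show ?thesis using H1_subset_holes by blast
qed

text \<open>As \<open>X\<close> survives, the balls of \<open>I\<close> alone have the same effect
  inside \<open>I\<close> in the full process as in the local one, where they fill everything;
  further balls cannot free a hole.\<close>

lemma H1_Int_finite:
  assumes "disjoint \<I>" "\<Union>\<I> = - X"
    and "\<And>I y. I \<in> \<I> \<Longrightarrow> y \<in> I \<Longrightarrow> y + 1 \<in> I \<union> X \<and> y - 1 \<in> I \<union> X"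
    and "X \<subseteq> H1 \<omega>" "I \<in> \<I>" "finite I" "loc \<omega> I I \<inter> I = {}"
  shows "H1 \<omega> \<inter> I = {}"
proof -
  have "X \<subseteq> {x. st \<omega> x = Hole}" using H1_subset_holes assms(4) by blast
  moreover have H: "H1 \<omega> \<subseteq> loc \<omega> UNIV I" using assms(6) by (simp add: subset_eq H1_iff)
  ultimately have "loc \<omega> I I = loc \<omega> UNIV I \<inter> I \<union> - I"
    using assms(4,5) by (intro loc_decompose(2)[OF _ assms(1-3) assms(6)]) auto
  then show ?thesis using H assms(7) by blast
qed

text \<open>Translations preserve the order of positions and hence the way ties are broken, so
  distinct clocks are not assumed here, in contrast to \<open>cyc_rot\<close>.\<close>

lemma order_of_shift:
  assumes "finite A"
  shows "order_of (\<lambda>x. \<omega> (x + c)) A = map (\<lambda>x. x - c) (order_of \<omega> ((\<lambda>x. x + c) ` A))"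
proof -
  have s: "sort_key f (map g xs) = map g (sort_key (\<lambda>x. f (g x)) xs)"
    for f :: "int \<Rightarrow> real" and g :: "int \<Rightarrow> int" and xs
  proof (induction xs)
    case (Cons x xs)
    have "insort_key f (g x) (map g ys) = map g (insort_key (\<lambda>x. f (g x)) x ys)" for ys
      by (induction ys) auto
    then show ?case using Cons by simp
  qed simp
  have "map (\<lambda>x. x + c) (sorted_list_of_set A) = sorted_list_of_set ((\<lambda>x. x + c) ` A)"
    by (rule sorted_distinct_set_unique)
       (use assms in \<open>auto simp: distinct_map inj_on_def sorted_map intro: sorted_wrt_mono_rel[of _ "(\<le>)"]\<close>)
  note m = this
  have "clock (\<lambda>x. \<omega> (x + c)) = (\<lambda>x. clock \<omega> (x + c))"
    "active (\<lambda>x. \<omega> (x + c)) = (\<lambda>x. active \<omega> (x + c))"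
    by (auto simp: active_def st_def clock_def fun_eq_iff)
  then show ?thesis
    unfolding order_of_def m[symmetric] filter_map s by (simp add: o_def)
qed

lemma loc_shift:
  assumes "finite A"
  shows "loc (\<lambda>x. \<omega> (x + c)) I A = (\<lambda>y. y - c) ` loc \<omega> ((\<lambda>y. y + c) ` I) ((\<lambda>y. y + c) ` A)"
proof -
  let ?p = "\<lambda>y::int. y + c" and ?m = "\<lambda>y::int. y - c"
  have 1: "?p ` (A \<inter> I) = ?p ` A \<inter> ?p ` I" by (auto intro!: image_eqI)
  have 2: "{x. st (\<lambda>x. \<omega> (x + c)) x = Hole} \<inter> I \<union> - I
     = ?m ` ({x. st \<omega> x = Hole} \<inter> ?p ` I \<union> - ?p ` I)"
  proof (intro set_eqI)
    fix y
    have "y \<in> ?m ` S \<longleftrightarrow> y + c \<in> S" for S :: "int set" by (force simp: image_iff)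
    moreover have "y + c \<in> ?p ` I \<longleftrightarrow> y \<in> I" by (auto simp: image_iff)
    ultimately show "y \<in> {x. st (\<lambda>x. \<omega> (x + c)) x = Hole} \<inter> I \<union> - I
     \<longleftrightarrow> y \<in> ?m ` ({x. st \<omega> x = Hole} \<inter> ?p ` I \<union> - ?p ` I)" by (simp add: st_def)
  qed
  show ?thesis
    unfolding loc_def 2 order_of_shift[OF finite_Int[OF disjI1[OF assms]]] 1
    by (rule proc_inj) (auto simp: inj_def walk_pos_def)
qed

section \<open>The golf space\<close>

lemma prob_space_site: "prob_space (site_measure rb rh p)"
  unfolding site_measure_def
  by (intro prob_space_pair prob_space_measure_pmf prob_space_uniform_measure prob_space_PiM) auto

lemma space_site [simp]: "space (site_measure rb rh p) = UNIV"
  by (auto simp: site_measure_def space_pair_measure space_PiM)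

lemma space_golf [simp]: "space (golf_space rb rh p) = UNIV"
  by (auto simp: golf_space_def space_PiM)

lemma prob_space_golf: "prob_space (golf_space rb rh p)"
  unfolding golf_space_def by (intro prob_space_PiM prob_space_site)

lemma sets_site:
  "sets (site_measure rb rh p) =
     sets (count_space UNIV \<Otimes>\<^sub>M (borel \<Otimes>\<^sub>M PiM UNIV (\<lambda>_::nat. count_space (UNIV::bool set))))"
  unfolding site_measure_def by (intro sets_pair_measure_cong sets_PiM_cong) auto

lemma measurable_site_state [measurable]: "fst \<in> site_measure rb rh p \<rightarrow>\<^sub>M count_space UNIV"
  and measurable_site_clock [measurable]: "(\<lambda>s. fst (snd s)) \<in> site_measure rb rh p \<rightarrow>\<^sub>M borel"
  and measurable_site_step [measurable]: "(\<lambda>s. snd (snd s) j) \<in> site_measure rb rh p \<rightarrow>\<^sub>M count_space UNIV"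
  unfolding measurable_cong_sets[OF sets_site refl] by measurable

lemma measurable_coordinate [measurable]: "(\<lambda>\<omega>. \<omega> x) \<in> golf_space rb rh p \<rightarrow>\<^sub>M site_measure rb rh p"
  unfolding golf_space_def by measurable

lemma measurable_st [measurable]: "(\<lambda>\<omega>. st \<omega> x) \<in> golf_space rb rh p \<rightarrow>\<^sub>M count_space UNIV"
  and measurable_clock [measurable]: "(\<lambda>\<omega>. clock \<omega> x) \<in> golf_space rb rh p \<rightarrow>\<^sub>M borel"
  unfolding st_def clock_def by measurable

lemma pred_active [measurable]: "Measurable.pred (golf_space rb rh p) (\<lambda>\<omega>. active \<omega> x)"
  unfolding active_def by measurable

lemma pred_step [measurable]: "Measurable.pred (golf_space rb rh p) (\<lambda>\<omega>. snd (snd (\<omega> x)) j)"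
  using measurable_compose[OF measurable_coordinate measurable_site_step] by simp

lemma pred_walk_pos [measurable]: "Measurable.pred (golf_space rb rh p) (\<lambda>\<omega>. walk_pos \<omega> x k = y)"
proof (induction k arbitrary: y)
  case (Suc k)
  have "(\<lambda>\<omega>. walk_pos \<omega> x (Suc k) = y) =
    (\<lambda>\<omega>. if snd (snd (\<omega> x)) k then walk_pos \<omega> x k = y - 1 else walk_pos \<omega> x k = y + 1)"
    by (auto simp: walk_pos_def fun_eq_iff)
  then show ?case using Suc by simp
qed simp

text \<open>Both the trajectory and the set are random; the membership
  \<open>w \<omega> k \<in> F \<omega>\<close> is split according to the countably many possible
  values of the position.\<close>

lemma pred_fill:
  assumes "\<And>k y. Measurable.pred M (\<lambda>\<omega>. w \<omega> k = y)" "\<And>y. Measurable.pred M (\<lambda>\<omega>. y \<in> F \<omega>)"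
  shows "Measurable.pred M (\<lambda>\<omega>. y \<in> fill (w \<omega>) (F \<omega>))"
proof -
  have "(w \<omega> k \<in> F \<omega>) \<longleftrightarrow> (\<exists>z. w \<omega> k = z \<and> z \<in> F \<omega>)" for \<omega> k by simp
  note [measurable] = assms
  have [measurable]: "Measurable.pred M (\<lambda>\<omega>. w \<omega> k \<in> F \<omega>)" for k
    unfolding \<open>\<And>\<omega> k. (w \<omega> k \<in> F \<omega>) \<longleftrightarrow> (\<exists>z. w \<omega> k = z \<and> z \<in> F \<omega>)\<close> by measurable
  show ?thesis unfolding fill_def hits_def by simp
qed

lemma pred_proc:
  assumes "\<And>x k y. Measurable.pred M (\<lambda>\<omega>. w \<omega> x k = y)" "\<And>y. Measurable.pred M (\<lambda>\<omega>. y \<in> F \<omega>)"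
  shows "Measurable.pred M (\<lambda>\<omega>. y \<in> proc (w \<omega>) L (F \<omega>))"
  using assms(2)
proof (induction L arbitrary: F y)
  case (Cons x L)
  show ?case unfolding proc_Cons by (intro Cons.IH pred_fill assms Cons.prems)
qed simp

lemma measurable_order_of [measurable]:
  "(\<lambda>\<omega>. order_of \<omega> A) \<in> golf_space rb rh p \<rightarrow>\<^sub>M count_space UNIV"
proof -
  let ?M = "golf_space rb rh p"
  have ins: "(\<lambda>\<omega>. insort_key (clock \<omega>) x L) \<in> ?M \<rightarrow>\<^sub>M count_space UNIV" for x L
  proof (induction L)
    case (Cons y L)
    have "(\<lambda>\<omega>. y # insort_key (clock \<omega>) x L) \<in> ?M \<rightarrow>\<^sub>M count_space UNIV"
      by (rule measurable_compose[OF Cons]) simp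
    then show ?case by simp
  qed simp
  have "(\<lambda>\<omega>. sort_key (clock \<omega>) (filter (active \<omega>) xs)) \<in> ?M \<rightarrow>\<^sub>M count_space UNIV" for xs
  proof (induction xs)
    case (Cons x xs)
    have "(\<lambda>\<omega>. insort_key (clock \<omega>) x (sort_key (clock \<omega>) (filter (active \<omega>) xs))) \<in> ?M \<rightarrow>\<^sub>M count_space UNIV"
      by (rule measurable_compose_countable[OF ins Cons])
    moreover have "(\<lambda>\<omega>. sort_key (clock \<omega>) (filter (active \<omega>) (x # xs))) =
      (\<lambda>\<omega>. if active \<omega> x then insort_key (clock \<omega>) x (sort_key (clock \<omega>) (filter (active \<omega>) xs))
           else sort_key (clock \<omega>) (filter (active \<omega>) xs))" by auto
    ultimately show ?case using Cons by (simp only: measurable_If pred_active[unfolded pred_def])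
  qed simp
  then show ?thesis by (simp add: order_of_def)
qed

text \<open>The order of the balls is a random variable with values in the countable type of integer
  lists, so it is enough to treat each fixed order.\<close>

lemma pred_proc_order_of:
  assumes "\<And>x k y. Measurable.pred (golf_space rb rh p) (\<lambda>\<omega>. w \<omega> x k = y)"
    and "\<And>y. Measurable.pred (golf_space rb rh p) (\<lambda>\<omega>. y \<in> F \<omega>)"
  shows "Measurable.pred (golf_space rb rh p) (\<lambda>\<omega>. y \<in> proc (w \<omega>) (order_of \<omega> A) (F \<omega>))"
  by (rule measurable_compose_countable[OF pred_proc[OF assms] measurable_order_of])

lemma pred_loc [measurable]: "Measurable.pred (golf_space rb rh p) (\<lambda>\<omega>. y \<in> loc \<omega> I A)"
  unfolding loc_def by (intro pred_proc_order_of) measurable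

lemma pred_H1 [measurable]: "Measurable.pred (golf_space rb rh p) (\<lambda>\<omega>. y \<in> H1 \<omega>)"
  unfolding H1_iff_nat by measurable

lemma pred_confined [measurable]: "Measurable.pred (golf_space rb rh p) (\<lambda>\<omega>. confined \<omega> I)"
proof -
  \<comment> \<open>Finite sets are represented by lists, which form a countable type; the
    quantifier over them becomes a countable intersection.\<close>
  have "confined \<omega> I \<longleftrightarrow> (\<forall>L. \<forall>y. y \<in> - I \<longrightarrow> y \<in> loc \<omega> I (set L))" for \<omega>
    unfolding confined_def using finite_list by (metis List.finite_set subset_eq)
  moreover have "Measurable.pred (golf_space rb rh p)
      (\<lambda>\<omega>. \<forall>L. \<forall>y. y \<in> - I \<longrightarrow> y \<in> loc \<omega> I (set L))"
    by measurable
  ultimately show ?thesis by presburger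
qed

section \<open>Invariance and independence of the sites\<close>

lemma measurable_golf_reindex:
  "(\<lambda>\<omega> x. \<omega> (f x)) \<in> golf_space rb rh p \<rightarrow>\<^sub>M golf_space rb rh p"
  unfolding golf_space_def by (rule measurable_PiM_single') (auto simp: space_PiM)

lemma golf_reindex:
  assumes "inj f" "Measurable.pred (golf_space rb rh p) Q"
  shows "measure (golf_space rb rh p) {\<omega>. Q (\<lambda>x. \<omega> (f x))} = measure (golf_space rb rh p) {\<omega>. Q \<omega>}"
proof -
  have "distr (golf_space rb rh p) (golf_space rb rh p) (\<lambda>\<omega> x. \<omega> (f x)) = golf_space rb rh p"
    using distr_PiM_reindex[of UNIV "\<lambda>_. site_measure rb rh p" f UNIV] assms(1) prob_space_site
    by (simp add: golf_space_def restrict_UNIV)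
  moreover have "measure (distr (golf_space rb rh p) (golf_space rb rh p) (\<lambda>\<omega> x. \<omega> (f x))) {\<omega>. Q \<omega>}
      = measure (golf_space rb rh p) {\<omega>. Q (\<lambda>x. \<omega> (f x))}"
    using assms(2) by (subst measure_distr[OF measurable_golf_reindex]) (auto simp: pred_def vimage_def)
  ultimately show ?thesis by simp
qed

lemma golf_indep_coordinates:
  "prob_space.indep_vars (golf_space rb rh p) (\<lambda>_. site_measure rb rh p) (\<lambda>x \<omega>. \<omega> x) (UNIV :: int set)"
proof -
  interpret prob_space "golf_space rb rh p" by (rule prob_space_golf)
  have "distr (golf_space rb rh p) (PiM UNIV (\<lambda>_. site_measure rb rh p)) (\<lambda>\<omega>. \<omega>) = golf_space rb rh p"
    unfolding golf_space_def[symmetric] by (rule distr_id)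
  moreover have "distr (golf_space rb rh p) (site_measure rb rh p) (\<lambda>\<omega>. \<omega> x) = site_measure rb rh p" for x
    unfolding golf_space_def by (rule distr_PiM_component) (auto intro: prob_space_site)
  ultimately show ?thesis
    by (subst indep_vars_iff_distr_eq_PiM) (auto simp: golf_space_def[symmetric] restrict_UNIV)
qed

text \<open>Locality is expressed as invariance under changes outside \<open>K j\<close>, so that
  events about whole configurations can be used without rewriting them as events on a product over
  \<open>K j\<close>.\<close>

lemma golf_indep_blocks:
  fixes K :: "'j \<Rightarrow> int set"
  assumes J: "finite J" "J \<noteq> {}" "disjoint_family_on K J"
    and meas: "\<And>j. j \<in> J \<Longrightarrow> Measurable.pred (golf_space rb rh p) (Q j)"
    and dep: "\<And>j \<omega> \<omega>'. j \<in> J \<Longrightarrow> (\<And>x. x \<in> K j \<Longrightarrow> \<omega> x = \<omega>' x) \<Longrightarrow> Q j \<omega> = Q j \<omega>'"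
  shows "measure (golf_space rb rh p) {\<omega>. \<forall>j\<in>J. Q j \<omega>} = (\<Prod>j\<in>J. measure (golf_space rb rh p) {\<omega>. Q j \<omega>})"
proof -
  interpret prob_space "golf_space rb rh p" by (rule prob_space_golf)
  let ?S = "site_measure rb rh p"
  \<comment> \<open>A partial configuration is completed by an arbitrary constant; by
    \<open>dep\<close> the choice does not affect \<open>Q j\<close>.\<close>
  define ext where "ext j \<eta> = (\<lambda>x. if x \<in> K j then \<eta> x else undefined)" for j and \<eta> :: "int \<Rightarrow> site"
  have ext: "ext j \<in> PiM (K j) (\<lambda>_. ?S) \<rightarrow>\<^sub>M golf_space rb rh p" for j
    unfolding golf_space_def ext_def
  proof (rule measurable_PiM_single')
    fix x :: int
    show "(\<lambda>\<omega>. if x \<in> K j then \<omega> x else undefined) \<in> PiM (K j) (\<lambda>_. ?S) \<rightarrow>\<^sub>M ?S"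
      by (cases "x \<in> K j") auto
  qed (auto simp: space_PiM)
  let ?A = "\<lambda>j. {\<eta> \<in> space (PiM (K j) (\<lambda>_. ?S)). Q j (ext j \<eta>)}"
  have A: "?A j \<in> sets (PiM (K j) (\<lambda>_. ?S))" if "j \<in> J" for j
    using measurable_compose[OF ext meas[OF that]] by (simp add: pred_def)
  have "indep_vars (\<lambda>j. PiM (K j) (\<lambda>_. ?S)) (\<lambda>j \<omega>. restrict (\<lambda>x. \<omega> x) (K j)) J"
    by (rule indep_vars_restrict[OF golf_indep_coordinates]) (use J in auto)
  from indep_varsD_finite[OF this J(2,1) A]
  have "prob (\<Inter>j\<in>J. (\<lambda>\<omega>. restrict \<omega> (K j)) -` ?A j \<inter> space (golf_space rb rh p)) =
     (\<Prod>j\<in>J. prob ((\<lambda>\<omega>. restrict \<omega> (K j)) -` ?A j \<inter> space (golf_space rb rh p)))" by simp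
  moreover have "(\<lambda>\<omega>. restrict \<omega> (K j)) -` ?A j \<inter> space (golf_space rb rh p) = {\<omega>. Q j \<omega>}" if "j \<in> J" for j
  proof -
    have "Q j (ext j (restrict \<omega> (K j))) = Q j \<omega>" for \<omega>
      by (rule dep[OF that]) (simp add: ext_def)
    then show ?thesis by (auto simp: space_PiM)
  qed
  moreover from this J(2) have "(\<Inter>j\<in>J. (\<lambda>\<omega>. restrict \<omega> (K j)) -` ?A j \<inter> space (golf_space rb rh p)) = {\<omega>. \<forall>j\<in>J. Q j \<omega>}"
    by auto
  ultimately show ?thesis by simp
qed

section \<open>The law of a single site\<close>

lemma golf_marginal:
  assumes "Measurable.pred (site_measure rb rh p) P"
  shows "measure (golf_space rb rh p) {\<omega>. P (\<omega> x)} = measure (site_measure rb rh p) {s. P s}"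
proof -
  have "distr (golf_space rb rh p) (site_measure rb rh p) (\<lambda>\<omega>. \<omega> x) = site_measure rb rh p"
    unfolding golf_space_def by (rule distr_PiM_component) (auto intro: prob_space_site)
  then have "measure (site_measure rb rh p) {s. P s} =
     measure (distr (golf_space rb rh p) (site_measure rb rh p) (\<lambda>\<omega>. \<omega> x)) {s. P s}" by simp
  also have "\<dots> = measure (golf_space rb rh p) {\<omega>. P (\<omega> x)}"
    using assms by (subst measure_distr[OF measurable_coordinate]) (auto simp: pred_def vimage_def)
  finally show ?thesis by simp
qed

lemma golf_marginal_AE:
  assumes "AE s in site_measure rb rh p. P s"
  shows "AE \<omega> in golf_space rb rh p. P (\<omega> x)"
  unfolding golf_space_def by (rule AE_PiM_component) (use assms in \<open>auto intro: prob_space_site\<close>)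

lemma site_state_clock:
  assumes "B \<in> sets borel"
  shows "measure (site_measure rb rh p) {s. fst s = a \<and> fst (snd s) \<in> B}
     = pmf (state_pmf rb rh) a * measure (uniform_measure lborel {0..1}) B"
proof -
  let ?U = "uniform_measure lborel {0..1::real}" and ?W = "PiM UNIV (\<lambda>_::nat. measure_pmf (bernoulli_pmf p))"
  interpret U: prob_space ?U by (rule prob_space_uniform_measure) auto
  interpret W: prob_space ?W by (rule prob_space_PiM) (rule prob_space_measure_pmf)
  interpret UW: prob_space "?U \<Otimes>\<^sub>M ?W" by (rule prob_space_pair) unfold_locales
  have "{s. fst s = a \<and> fst (snd s) \<in> B} = {a} \<times> (B \<times> (UNIV :: (nat \<Rightarrow> bool) set))" by auto
  moreover have "emeasure (site_measure rb rh p) ({a} \<times> (B \<times> UNIV)) =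
      emeasure (measure_pmf (state_pmf rb rh)) {a} * (emeasure ?U B * emeasure ?W UNIV)"
    using assms sets.top[of ?W] unfolding site_measure_def
    by (subst UW.emeasure_pair_measure_Times, simp, force simp: space_PiM, subst W.emeasure_pair_measure_Times)
       (auto simp: space_PiM)
  moreover have "emeasure ?W UNIV = 1" using W.emeasure_space_1 by (simp add: space_PiM)
  ultimately show ?thesis
    by (simp add: measure_def emeasure_pmf_single enn2real_mult)
qed

lemma pmf_state:
  assumes "0 \<le> rb" "rb < 1" "rb + rh = 1"
  shows "pmf (state_pmf rb rh) Ball = rb" "pmf (state_pmf rb rh) Hole = rh"
proof -
  \<comment> \<open>For \<open>rb + rh = 1\<close> a vertex that is not a ball is a hole with
    probability one, so neutral vertices disappear.\<close>
  have 1: "rh / (1 - rb) = 1" using assms by (simp add: field_simps)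
  have "bernoulli_pmf 1 = return_pmf True"
    by (rule pmf_eqI) (case_tac i, auto)
  then have "state_pmf rb rh = bind_pmf (bernoulli_pmf rb) (\<lambda>b. return_pmf (if b then Ball else Hole))"
    unfolding state_pmf_def 1 by (intro bind_pmf_cong) auto
  then show "pmf (state_pmf rb rh) Ball = rb" "pmf (state_pmf rb rh) Hole = rh"
    using assms by (auto simp: pmf_bind)
qed

lemma measure_hole:
  assumes "0 \<le> rb" "rb < 1" "rb + rh = 1"
  shows "measure (golf_space rb rh p) {\<omega>. st \<omega> x = Hole} = rh"
proof -
  interpret U: prob_space "uniform_measure lborel {0..1::real}" by (rule prob_space_uniform_measure) auto
  have "measure (golf_space rb rh p) {\<omega>. fst (\<omega> x) = Hole} = measure (site_measure rb rh p) {s. fst s = Hole}"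
    by (rule golf_marginal) measurable
  then show ?thesis
    using site_state_clock[of UNIV rb rh p Hole] U.prob_space pmf_state[OF assms] by (simp add: st_def)
qed

lemma measure_active:
  assumes "0 \<le> rb" "rb < 1" "rb + rh = 1"
  shows "measure (golf_space rb rh p) {\<omega>. active \<omega> x} = rb"
proof -
  have "measure (golf_space rb rh p) {\<omega>. fst (\<omega> x) = Ball \<and> fst (snd (\<omega> x)) \<in> {..1}}
      = measure (site_measure rb rh p) {s. fst s = Ball \<and> fst (snd s) \<in> {..1}}"
    by (rule golf_marginal) measurable
  also have "\<dots> = rb * measure (uniform_measure lborel {0..1}) {..1::real}"
    using site_state_clock[of "{..1}" rb rh p Ball] pmf_state[OF assms] by simp
  also have "measure (uniform_measure lborel {0..1}) {..1::real} = 1"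
  proof -
    have "{0..1} \<inter> {..1} = {0..1::real}" by auto
    then show ?thesis by (subst measure_uniform_measure) auto
  qed
  finally show ?thesis by (simp add: active_def st_def clock_def)
qed

section \<open>Almost sure properties of clocks and walks\<close>

lemma AE_site_clock_neq: "AE s in site_measure rb rh p. fst (snd s) \<noteq> c"
proof -
  interpret S: prob_space "site_measure rb rh p" by (rule prob_space_site)
  have "measure (uniform_measure lborel {0..1}) {c} = 0"
    by (subst measure_uniform_measure) (auto simp: measure_def emeasure_lborel_singleton Int_insert_right)
  hence z: "measure (site_measure rb rh p) {s. fst s = a \<and> fst (snd s) \<in> {c}} = 0" for a
    by (subst site_state_clock) auto
  have "AE s in site_measure rb rh p. \<not> (fst s = a \<and> fst (snd s) = c)" for a
  proof -
    have "Measurable.pred (site_measure rb rh p) (\<lambda>s. fst s = a \<and> fst (snd s) \<in> {c})" by measurable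
    then have "{s. fst s = a \<and> fst (snd s) \<in> {c}} \<in> sets (site_measure rb rh p)" by (simp add: pred_def)
    from S.prob_eq_0[OF this] z show ?thesis by simp
  qed
  then have "AE s in site_measure rb rh p. \<forall>a\<in>{Ball, Hole, Neutral}. \<not> (fst s = a \<and> fst (snd s) = c)"
    by simp
  then show ?thesis by eventually_elim (metis insertCI site_state.exhaust)
qed

text \<open>The joint law of two clocks is a product and the second clock almost surely avoids any
  given value, so Fubini excludes a tie; there are countably many pairs. Absence of ties is what
  rotation of the cycle requires.\<close>

lemma AE_inj_clock: "AE \<omega> in golf_space rb rh p. inj (clock \<omega>)"
proof -
  interpret prob_space "golf_space rb rh p" by (rule prob_space_golf)
  have "AE \<omega> in golf_space rb rh p. clock \<omega> x \<noteq> clock \<omega> y" if "x \<noteq> y" for x y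
  proof -
    let ?D = "\<lambda>x. distr (golf_space rb rh p) borel (\<lambda>\<omega>. clock \<omega> x)"
    interpret X: prob_space "?D x" by (rule prob_space_distr) simp
    interpret Y: prob_space "?D y" by (rule prob_space_distr) simp
    interpret XY: pair_sigma_finite "?D x" "?D y" ..
    have "indep_var (PiM {x} (\<lambda>_. site_measure rb rh p)) (\<lambda>\<omega>. restrict \<omega> {x})
        (PiM {y} (\<lambda>_. site_measure rb rh p)) (\<lambda>\<omega>. restrict \<omega> {y})"
      using that by (intro indep_var_restrict[OF golf_indep_coordinates]) auto
    from indep_var_compose[OF this, of "\<lambda>\<eta>. fst (snd (\<eta> x))" borel "\<lambda>\<eta>. fst (snd (\<eta> y))" borel]
    have "indep_var borel (\<lambda>\<omega>. clock \<omega> x) borel (\<lambda>\<omega>. clock \<omega> y)"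
      by (simp add: o_def clock_def)
    hence D: "distr (golf_space rb rh p) (borel \<Otimes>\<^sub>M borel) (\<lambda>\<omega>. (clock \<omega> x, clock \<omega> y)) = ?D x \<Otimes>\<^sub>M ?D y"
      by (simp add: indep_var_distribution_eq)
    have "AE b in ?D y. a \<noteq> b" for a
    proof -
      have "AE \<omega> in golf_space rb rh p. clock \<omega> y \<noteq> a"
        unfolding clock_def by (rule golf_marginal_AE[OF AE_site_clock_neq])
      then have "AE b in ?D y. b \<noteq> a" by (subst AE_distr_iff) auto
      then show ?thesis by eventually_elim simp
    qed
    then have "AE z in ?D x \<Otimes>\<^sub>M ?D y. fst z \<noteq> snd z"
    proof (intro XY.AE_pair_measure)
      have "Measurable.pred (?D x \<Otimes>\<^sub>M ?D y) (\<lambda>z. fst z \<noteq> snd z)" by measurable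
      then show "{z \<in> space (?D x \<Otimes>\<^sub>M ?D y). fst z \<noteq> snd z} \<in> sets (?D x \<Otimes>\<^sub>M ?D y)"
        unfolding pred_def .
    qed auto
    then show ?thesis
      unfolding D[symmetric] by (subst (asm) AE_distr_iff) auto
  qed
  then have "AE \<omega> in golf_space rb rh p. x \<noteq> y \<longrightarrow> clock \<omega> x \<noteq> clock \<omega> y" for x y
    by (cases "x = y") auto
  then have "AE \<omega> in golf_space rb rh p. \<forall>x y. x \<noteq> y \<longrightarrow> clock \<omega> x \<noteq> clock \<omega> y"
    by (simp add: AE_all_countable)
  then show ?thesis by eventually_elim (auto simp: inj_def)
qed

text \<open>Splitting off the first \<open>n\<close> steps shows that the probability \<open>a\<close> of having no run of \<open>n\<close> equal values
  \<open>v\<close> satisfies \<open>a \<le> (1 - q ^ n) * a\<close>, where \<open>q > 0\<close> is the probability of \<open>v\<close>.\<close>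
lemma AE_bernoulli_run:
  assumes "0 \<le> p" "p \<le> 1"
  shows "AE s in PiM UNIV (\<lambda>_::nat. measure_pmf (bernoulli_pmf p)). \<exists>v k. \<forall>i<n. s (k + i) = v"
proof -
  interpret sequence_space "measure_pmf (bernoulli_pmf p)" by unfold_locales
  interpret SS: pair_prob_space S S ..
  \<comment> \<open>One of the two steps has positive probability, also when \<open>p\<close> is 0
    or 1.\<close>
  obtain v where v: "pmf (bernoulli_pmf p) v > 0"
    using set_pmf_not_empty[of "bernoulli_pmf p"] by (blast intro: pmf_positive)
  define B where "B = {s :: nat \<Rightarrow> bool. \<forall>i\<in>{..<n}. s i = v}"
  define A where "A = {s :: nat \<Rightarrow> bool. \<forall>k. \<exists>i<n. s (k + i) \<noteq> v}"
  have sp: "space S = UNIV" by (simp add: space_PiM)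
  have [measurable]: "(\<lambda>s. s i) \<in> S \<rightarrow>\<^sub>M count_space UNIV" for i
    using measurable_component_singleton[of i UNIV "\<lambda>_. measure_pmf (bernoulli_pmf p)"] by simp
  have "Measurable.pred S (\<lambda>s. \<forall>k. \<exists>i<n. s (k + i) \<noteq> v)" "Measurable.pred S (\<lambda>s. \<forall>i\<in>{..<n}. s i = v)"
    by measurable
  hence sets: "A \<in> sets S" "B \<in> sets S" by (auto simp: pred_def sp A_def B_def)
  have mB: "- B \<in> sets S" using sets.compl_sets[OF sets(2)] sp by (simp add: Compl_eq_Diff_UNIV)
  have "emeasure S {s \<in> space S. \<forall>i\<in>{..<n}. s i \<in> {v}} = (\<Prod>i<n. emeasure (measure_pmf (bernoulli_pmf p)) {v})"
    by (rule emeasure_PiM_Collect) auto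
  hence B: "P.prob B = pmf (bernoulli_pmf p) v ^ n"
    by (simp add: B_def sp measure_def emeasure_pmf_single ennreal_power enn2real_ennreal)
  have "P.prob A = measure (distr (S \<Otimes>\<^sub>M S) S (\<lambda>(s, s'). comb_seq n s s')) A"
    by (simp only: PiM_comb_seq)
  also have "\<dots> = measure (S \<Otimes>\<^sub>M S) ((\<lambda>(s, s'). comb_seq n s s') -` A \<inter> space (S \<Otimes>\<^sub>M S))"
    by (rule measure_distr[OF measurable_comb_seq sets(1)])
  also have "\<dots> \<le> measure (S \<Otimes>\<^sub>M S) ((- B) \<times> A)"
  proof (rule SS.P.finite_measure_mono)
    have "s \<notin> B \<and> s' \<in> A" if "comb_seq n s s' \<in> A" for s s'
    proof
      have "\<exists>i<n. comb_seq n s s' (0 + i) \<noteq> v" using that unfolding A_def by blast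
      then show "s \<notin> B" by (auto simp: B_def comb_seq_def)
      have "\<exists>i<n. comb_seq n s s' ((k + n) + i) \<noteq> v" for k using that unfolding A_def by blast
      then show "s' \<in> A" by (auto simp: A_def comb_seq_def)
    qed
    then show "(\<lambda>(s, s'). comb_seq n s s') -` A \<inter> space (S \<Otimes>\<^sub>M S) \<subseteq> (- B) \<times> A" by auto
    show "(- B) \<times> A \<in> sets (S \<Otimes>\<^sub>M S)" using sets mB by auto
  qed
  also have "\<dots> = P.prob (- B) * P.prob A"
    using sets mB by (simp add: measure_def P.emeasure_pair_measure_Times enn2real_mult)
  also have "P.prob (- B) = 1 - pmf (bernoulli_pmf p) v ^ n"
    using P.prob_compl[OF sets(2)] by (simp add: sp B Compl_eq_Diff_UNIV)
  finally have "pmf (bernoulli_pmf p) v ^ n * P.prob A \<le> 0" by (simp add: algebra_simps)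
  hence "P.prob A = 0" using zero_less_power[OF v, of n] by (simp add: mult_le_0_iff measure_le_0_iff not_le)
  then have "AE s in S. s \<notin> A" using P.prob_eq_0[OF sets(1)] by simp
  then show ?thesis by eventually_elim (auto simp: A_def)
qed

lemma AE_walk_exits:
  assumes "0 \<le> p" "p \<le> 1"
  shows "AE \<omega> in golf_space rb rh p. \<forall>x. \<forall>N::nat. \<exists>k. \<bar>walk_pos \<omega> x k - x\<bar> > int N"
proof -
  let ?U = "uniform_measure lborel {0..1::real}" and ?W = "PiM UNIV (\<lambda>_::nat. measure_pmf (bernoulli_pmf p))"
  interpret U: prob_space ?U by (rule prob_space_uniform_measure) auto
  interpret W: prob_space ?W by (rule prob_space_PiM) (rule prob_space_measure_pmf)
  interpret UW: prob_space "?U \<Otimes>\<^sub>M ?W" by (rule prob_space_pair) unfold_locales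
  interpret St: prob_space "measure_pmf (state_pmf rb rh)" by (rule prob_space_measure_pmf)
  interpret PUW: pair_sigma_finite ?U ?W ..
  interpret PS: pair_sigma_finite "measure_pmf (state_pmf rb rh)" "?U \<Otimes>\<^sub>M ?W" ..
  define R where "R n s = (\<exists>v k. \<forall>i<n. s (k + i) = v)" for n and s :: "nat \<Rightarrow> bool"
  have "AE s in ?W. R n s" for n using AE_bernoulli_run[OF assms] unfolding R_def .
  have [measurable]: "(\<lambda>s. s i) \<in> ?W \<rightarrow>\<^sub>M count_space UNIV" for i
    using measurable_component_singleton[of i UNIV "\<lambda>_. measure_pmf (bernoulli_pmf p)"] by simp
  have [measurable]: "Measurable.pred ?W (R n)" for n unfolding R_def by measurable
  have "AE z in ?U \<Otimes>\<^sub>M ?W. R n (snd z)" for n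
  proof (intro PUW.AE_pair_measure)
    have "Measurable.pred (?U \<Otimes>\<^sub>M ?W) (\<lambda>z. R n (snd z))" by measurable
    then show "{z \<in> space (?U \<Otimes>\<^sub>M ?W). R n (snd z)} \<in> sets (?U \<Otimes>\<^sub>M ?W)" unfolding pred_def .
  qed (use \<open>AE s in ?W. R n s\<close> in simp)
  then have "AE s in site_measure rb rh p. R n (snd (snd s))" for n
    unfolding site_measure_def
  proof (intro PS.AE_pair_measure)
    let ?M = "measure_pmf (state_pmf rb rh) \<Otimes>\<^sub>M (?U \<Otimes>\<^sub>M ?W)"
    have "Measurable.pred ?M (\<lambda>z. R n (snd (snd z)))" by measurable
    then show "{z \<in> space ?M. R n (snd (snd z))} \<in> sets ?M" unfolding pred_def .
  qed simp
  then have "AE \<omega> in golf_space rb rh p. R n (snd (snd (\<omega> x)))" for n x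
    by (rule golf_marginal_AE[of "\<lambda>s. R n (snd (snd s))"])
  then have "AE \<omega> in golf_space rb rh p. \<forall>x n. R n (snd (snd (\<omega> x)))"
    by (simp add: AE_all_countable)
  then show ?thesis
  proof eventually_elim
    case (elim \<omega>)
    show ?case
    proof (intro allI)
      fix x and N :: nat
      \<comment> \<open>After \<open>2 * N + 1\<close> equal steps the walk has moved by
        \<open>2 * N + 1\<close>, so the two ends of the run cannot both lie within distance
        \<open>N\<close> of the start.\<close>
      obtain v k where vk: "\<And>i. i < 2 * N + 1 \<Longrightarrow> snd (snd (\<omega> x)) (k + i) = v"
        using elim[rule_format, of "2 * N + 1" x] unfolding R_def by blast
      have "walk_pos \<omega> x (k + m) = walk_pos \<omega> x k + (if v then int m else - int m)" if "m \<le> 2 * N + 1" for m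
        using that
      proof (induction m)
        case (Suc m)
        have s: "snd (snd (\<omega> x)) (k + m) = v" using Suc.prems by (intro vk) simp
        have "walk_pos \<omega> x (k + Suc m) = walk_pos \<omega> x (k + m) + (if v then 1 else - 1)"
          by (simp add: walk_pos_def s)
        moreover have "m \<le> 2 * N + 1" using Suc.prems by simp
        ultimately show ?case using Suc.IH by (cases v) simp_all
      qed simp
      from this[OF order_refl] have "\<bar>walk_pos \<omega> x (k + (2 * N + 1)) - walk_pos \<omega> x k\<bar> = 2 * int N + 1"
        by (cases v) simp_all
      then have "\<bar>walk_pos \<omega> x (k + (2 * N + 1)) - x\<bar> > int N \<or> \<bar>walk_pos \<omega> x k - x\<bar> > int N" by linarith
      then show "\<exists>k. \<bar>walk_pos \<omega> x k - x\<bar> > int N" by blast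
    qed
  qed
qed

section \<open>Blocks and their translations\<close>

lemma confined_shift: "confined (\<lambda>x. \<omega> (x + c)) I \<longleftrightarrow> confined \<omega> ((\<lambda>y. y + c) ` I)"
proof -
  let ?p = "\<lambda>y::int. y + c" and ?m = "\<lambda>y::int. y - c"
  have m: "y \<in> ?m ` S \<longleftrightarrow> ?p y \<in> S" for y and S :: "int set" by (force simp: image_iff)
  have "- I \<subseteq> loc (\<lambda>x. \<omega> (x + c)) I A \<longleftrightarrow> - ?p ` I \<subseteq> loc \<omega> (?p ` I) (?p ` A)" if "finite A" for A
    unfolding loc_shift[OF that] subset_eq Ball_def m
    by (metis (no_types, lifting) Compl_iff diff_add_cancel imageE imageI add_right_imp_eq)
  moreover have "\<exists>A'. finite A' \<and> A = ?p ` A'" if "finite A" for A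
    using that by (intro exI[of _ "?m ` A"]) (simp add: image_image)
  ultimately show ?thesis unfolding confined_def by (metis finite_imageI)
qed

text \<open>A free hole at \<open>a\<close> followed by a gap that ends at \<open>d\<close>: no ball
  leaves the gap and no hole in it stays free. The vertex \<open>a\<close> belongs to the block and
  \<open>d\<close> does not, so consecutive blocks depend on disjoint sets of vertices.\<close>

definition block :: "(int \<Rightarrow> site) \<Rightarrow> int \<Rightarrow> int \<Rightarrow> bool" where
  "block \<omega> a d \<longleftrightarrow> st \<omega> a = Hole \<and> confined \<omega> {a<..<d} \<and>
     (\<forall>y\<in>{a<..<d}. y \<notin> loc \<omega> {a<..<d} {a<..<d})"

lemma block_shift: "block (\<lambda>x. \<omega> (x + a)) 0 d \<longleftrightarrow> block \<omega> a (d + a)"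
proof -
  have im: "(\<lambda>y::int. y + a) ` {0<..<d} = {a<..<d + a}" by (auto intro!: image_eqI[of _ _ "_ - a"])
  have m: "y \<in> (\<lambda>y. y - a) ` S \<longleftrightarrow> y + a \<in> S" for y and S :: "int set" by (force simp: image_iff)
  have "(\<forall>y\<in>{0<..<d}. y + a \<notin> S) \<longleftrightarrow> (\<forall>y\<in>{a<..<d + a}. y \<notin> S)" for S
    unfolding im[symmetric] by simp
  then show ?thesis
    unfolding block_def confined_shift im loc_shift[OF finite_greaterThanLessThan_int] m by (simp add: st_def)
qed

lemma pred_block [measurable]: "Measurable.pred (golf_space rb rh p) (\<lambda>\<omega>. block \<omega> a d)"
  unfolding block_def by measurable

lemma measure_block_shift:
  "measure (golf_space rb rh p) {\<omega>. block \<omega> a (d + a)} = measure (golf_space rb rh p) {\<omega>. block \<omega> 0 d}"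
  using golf_reindex[where f = "\<lambda>x. x + a" and Q = "\<lambda>\<omega>. block \<omega> 0 d"] by (simp add: block_shift)

section \<open>The process on a cycle\<close>

text \<open>The walks are those of the line, reduced modulo \<open>N\<close>. Process on the cycle
  and process on the line thus share their randomness and can be compared for each
  configuration.\<close>

definition cyc :: "int \<Rightarrow> (int \<Rightarrow> site) \<Rightarrow> int set" where
  "cyc N \<omega> = proc (\<lambda>x k. walk_pos \<omega> x k mod N) (order_of \<omega> {0..<N}) ({x. st \<omega> x = Hole} \<inter> {0..<N})"

text \<open>The identity outside the cycle makes the map injective on all integers, as
  \<open>proc_inj\<close> and \<open>golf_reindex\<close> demand.\<close>

definition rot :: "int \<Rightarrow> int \<Rightarrow> int \<Rightarrow> int" where
  "rot N c y = (if y \<in> {0..<N} then (y + c) mod N else y)"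

lemma inj_rot: "0 < N \<Longrightarrow> inj (rot N c)"
proof (rule injI)
  fix y z assume N: "0 < N" and e: "rot N c y = rot N c z"
  have r: "rot N c u \<in> {0..<N} \<longleftrightarrow> u \<in> {0..<N}" for u
    using N by (simp add: rot_def)
  have yz: "y \<in> {0..<N} \<longleftrightarrow> z \<in> {0..<N}" using r[of y] r[of z] e by simp
  show "y = z"
  proof (cases "y \<in> {0..<N}")
    case True
    have u: "((u + c) mod N - c) mod N = u mod N" for u by (simp add: mod_diff_left_eq)
    have "(y + c) mod N = (z + c) mod N" using e True yz by (simp add: rot_def)
    then have "y mod N = z mod N" using u[of y] u[of z] by simp
    then show ?thesis using True yz by simp
  next
    case False
    then have "z \<notin> {0..<N}" using yz by blast
    then show ?thesis using e[unfolded rot_def] False by (simp only: if_False)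
  qed
qed

lemma rot_image: assumes "0 < N" shows "rot N c ` {0..<N} = {0..<N}"
  by (rule endo_inj_surj)
     (use assms in \<open>auto simp: rot_def intro: inj_on_subset[OF inj_rot[OF assms]]\<close>)

lemma rot_Collect:
  assumes "0 < N" shows "rot N c ` {x \<in> {0..<N}. P (rot N c x)} = {x \<in> {0..<N}. P x}"
proof -
  have "rot N c ` {x \<in> {0..<N}. P (rot N c x)} = {y \<in> rot N c ` {0..<N}. P y}" by auto
  then show ?thesis unfolding rot_image[OF assms] .
qed

text \<open>A rotation does not respect the order of positions and would break ties differently.
  With distinct clocks, however, the list of balls is determined by its set and by being
  sorted.\<close>

lemma cyc_rot:
  assumes N: "0 < N" and inj: "inj (clock \<omega>)"
  shows "cyc N \<omega> = rot N c ` cyc N (\<lambda>x. \<omega> (rot N c x))"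
proof -
  let ?s = "rot N c" and ?o = "\<lambda>x. \<omega> (rot N c x)"
  have c: "clock ?o = (\<lambda>x. clock \<omega> (?s x))" "active ?o = (\<lambda>x. active \<omega> (?s x))"
    by (auto simp: clock_def active_def st_def)
  have "order_of \<omega> {0..<N} = map ?s (order_of ?o {0..<N})"
    unfolding order_of_def[of \<omega>]
  proof (rule sort_key_inj_key_eq)
    have "set (map ?s (order_of ?o {0..<N})) = {x \<in> {0..<N}. active \<omega> x}"
      using rot_Collect[OF N, of c "active \<omega>"] by (simp add: set_order_of c)
    moreover have "distinct (map ?s (order_of ?o {0..<N}))"
      by (auto simp: distinct_map order_of_def intro: inj_on_subset[OF inj_rot[OF N]])
    ultimately show "mset (filter (active \<omega>) (sorted_list_of_set {0..<N})) = mset (map ?s (order_of ?o {0..<N}))"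
      by (subst set_eq_iff_mset_eq_distinct[symmetric]) auto
    show "inj_on (clock \<omega>) (set (filter (active \<omega>) (sorted_list_of_set {0..<N})))"
      using inj by (rule inj_on_subset) simp
    have "map (clock \<omega>) (map ?s (order_of ?o {0..<N})) = map (clock ?o) (order_of ?o {0..<N})"
      by (simp add: c o_def)
    then show "sorted (map (clock \<omega>) (map ?s (order_of ?o {0..<N})))"
      by (simp only: order_of_def sorted_sort_key)
  qed
  moreover have "{x. st \<omega> x = Hole} \<inter> {0..<N} = ?s ` ({x. st ?o x = Hole} \<inter> {0..<N})"
    using rot_Collect[OF N, of c "\<lambda>x. st \<omega> x = Hole"] by (simp add: st_def Int_def conj_commute)
  moreover have "walk_pos \<omega> (?s x) k mod N = ?s (walk_pos ?o x k mod N)" if "x \<in> {0..<N}" for x k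
  proof -
    define S where "S = (\<Sum>j<k. if snd (snd (\<omega> (?s x))) j then 1 else - 1 :: int)"
    have "walk_pos \<omega> (?s x) k mod N = ((x + c) mod N + S) mod N"
      using that by (simp add: walk_pos_def S_def) (simp add: rot_def)
    also have "\<dots> = ((x + S) mod N + c) mod N"
      by (simp add: mod_simps ac_simps)
    also have "\<dots> = ?s (walk_pos ?o x k mod N)"
      using N by (simp add: rot_def walk_pos_def S_def)
    finally show ?thesis .
  qed
  ultimately show ?thesis
    unfolding cyc_def by (simp only:) (rule proc_inj[OF inj_rot[OF N]], auto simp: set_order_of)
qed

lemma pred_cyc [measurable]: "Measurable.pred (golf_space rb rh p) (\<lambda>\<omega>. y \<in> cyc N \<omega>)"
proof -
  have "(walk_pos \<omega> x k mod N = y) \<longleftrightarrow> (\<exists>z. walk_pos \<omega> x k = z \<and> z mod N = y)" for \<omega> x k y by blast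
  then have "Measurable.pred (golf_space rb rh p) (\<lambda>\<omega>. walk_pos \<omega> x k mod N = y)" for x k y
    by (simp only:) measurable
  then show ?thesis unfolding cyc_def by (rule pred_proc_order_of) measurable
qed

definition balanced :: "nat \<Rightarrow> (int \<Rightarrow> site) \<Rightarrow> bool" where
  "balanced b \<omega> \<longleftrightarrow> card {x \<in> {0..<2 * int b + 1}. active \<omega> x} = b \<and>
     card {x \<in> {0..<2 * int b + 1}. st \<omega> x = Hole} = b + 1"

lemma pred_card:
  fixes A :: "int set"
  assumes "finite A" "\<And>x. Measurable.pred M (P x)"
  shows "Measurable.pred M (\<lambda>\<omega>. card {x \<in> A. P x \<omega>} = n)"
proof -
  have "card {x \<in> A. P x \<omega>} = (\<Sum>x\<in>A. if P x \<omega> then 1 else 0)" for \<omega>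
    using assms(1) by (simp add: sum.If_cases Int_def)
  moreover have "(\<lambda>\<omega>. \<Sum>x\<in>A. if P x \<omega> then 1 else (0::nat)) \<in> M \<rightarrow>\<^sub>M count_space UNIV"
    using assms(2) by measurable
  ultimately show ?thesis by simp
qed

lemma pred_balanced [measurable]: "Measurable.pred (golf_space rb rh p) (balanced b)"
  unfolding balanced_def[abs_def] by (intro pred_intros_logic pred_card) measurable

lemma balanced_rot: "balanced b (\<lambda>x. \<omega> (rot (2 * int b + 1) c x)) \<longleftrightarrow> balanced b \<omega>"
proof -
  let ?N = "2 * int b + 1"
  have "card {x \<in> {0..<?N}. P (rot ?N c x)} = card {x \<in> {0..<?N}. P x}" for P
    using card_image[OF inj_on_subset[OF inj_rot[of ?N c] subset_UNIV], of "{x \<in> {0..<?N}. P (rot ?N c x)}"]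
      rot_Collect[of ?N c P] by simp
  from this[of "active \<omega>"] this[of "\<lambda>x. st \<omega> x = Hole"] show ?thesis
    by (simp add: balanced_def active_def st_def clock_def)
qed

lemma cyc_nonempty: "balanced b \<omega> \<Longrightarrow> \<exists>c\<in>{0..<2 * int b + 1}. c \<in> cyc (2 * int b + 1) \<omega>"
proof -
  assume bal: "balanced b \<omega>"
  let ?N = "2 * int b + 1"
  have "card ({x. st \<omega> x = Hole} \<inter> {0..<?N} \<inter> {0..<?N})
     \<le> card (cyc ?N \<omega> \<inter> {0..<?N}) + length (order_of \<omega> {0..<?N})"
    unfolding cyc_def by (rule card_proc_ge) simp
  moreover have "{x. st \<omega> x = Hole} \<inter> {0..<?N} \<inter> {0..<?N} = {x \<in> {0..<?N}. st \<omega> x = Hole}" by auto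
  ultimately have "card (cyc ?N \<omega> \<inter> {0..<?N}) > 0"
    using bal by (simp add: length_order_of balanced_def)
  then show ?thesis by (metis IntE card_gt_0_iff equals0I)
qed

text \<open>There is one event for each choice \<open>S\<close> of the \<open>b\<close> ball
  positions, the other \<open>b + 1\<close> vertices being holes. These events are disjoint and
  equally likely.\<close>

lemma measure_balanced_ge:
  assumes "0 \<le> rb" "rb < 1" "rb + rh = 1"
  shows "real ((2 * b + 1) choose b) * rb ^ b * rh ^ (b + 1) \<le> measure (golf_space rb rh p) {\<omega>. balanced b \<omega>}"
proof -
  interpret prob_space "golf_space rb rh p" by (rule prob_space_golf)
  let ?A = "{0..<2 * int b + 1}"
  define Q where "Q S x \<omega> = (if x \<in> S then active \<omega> x else st \<omega> x = Hole)" for S x \<omega>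
  define T where "T S = {\<omega>. \<forall>x\<in>?A. Q S x \<omega>}" for S
  define \<S> where "\<S> = {S. S \<subseteq> ?A \<and> card S = b}"
  have [measurable]: "Measurable.pred (golf_space rb rh p) (Q S x)" for S x unfolding Q_def by measurable
  have "Measurable.pred (golf_space rb rh p) (\<lambda>\<omega>. \<forall>x\<in>?A. Q S x \<omega>)" for S by measurable
  then have mT: "T S \<in> events" for S unfolding T_def pred_def by simp
  have fin: "finite \<S>" unfolding \<S>_def by (rule finite_subset[of _ "Pow ?A"]) auto
  have pT: "prob (T S) = rb ^ b * rh ^ (b + 1)" if "S \<in> \<S>" for S
  proof -
    have "prob (T S) = (\<Prod>x\<in>?A. prob {\<omega>. Q S x \<omega>})"
      unfolding T_def
      by (rule golf_indep_blocks[where K = "\<lambda>x. {x}"])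
         (auto simp: disjoint_family_on_def Q_def active_def st_def clock_def)
    also have "\<dots> = (\<Prod>x\<in>?A. if x \<in> S then rb else rh)"
      by (intro prod.cong refl) (simp add: Q_def measure_hole[OF assms] measure_active[OF assms])
    also have "\<dots> = rb ^ card (?A \<inter> S) * rh ^ card (?A \<inter> - S)"
      by (subst prod.If_cases) auto
    also have "?A \<inter> S = S" using that by (auto simp: \<S>_def)
    also have "?A \<inter> - S = ?A - S" by auto
    also have "card (?A - S) = b + 1"
      using that card_Diff_subset[of S ?A] finite_subset[of S ?A] by (auto simp: \<S>_def)
    finally show ?thesis using that by (simp add: \<S>_def)
  qed
  have act: "{x \<in> ?A. active \<omega> x} = S" and hol: "{x \<in> ?A. st \<omega> x = Hole} = ?A - S"
    if "\<omega> \<in> T S" "S \<in> \<S>" for \<omega> S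
    using that by (auto simp: T_def Q_def \<S>_def active_def split: if_splits)
  have disj: "disjoint_family_on T \<S>"
    unfolding disjoint_family_on_def using act by blast
  have "real ((2 * b + 1) choose b) * (rb ^ b * rh ^ (b + 1)) = (\<Sum>S\<in>\<S>. prob (T S))"
    using n_subsets[of ?A b] by (simp add: pT \<S>_def nat_add_distrib nat_mult_distrib)
  also have "\<dots> = prob (\<Union>S\<in>\<S>. T S)"
    by (rule finite_measure_finite_Union[symmetric]) (use fin mT disj in auto)
  also have "\<dots> \<le> prob {\<omega>. balanced b \<omega>}"
  proof (rule finite_measure_mono)
    show "(\<Union>S\<in>\<S>. T S) \<subseteq> {\<omega>. balanced b \<omega>}"
    proof safe
      fix \<omega> S assume h: "\<omega> \<in> T S" "S \<in> \<S>"
      then have "card S = b" "card (?A - S) = b + 1"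
        using card_Diff_subset[of S ?A] finite_subset[of S ?A] by (auto simp: \<S>_def)
      then show "balanced b \<omega>" unfolding balanced_def act[OF h] hol[OF h] by simp
    qed
    show "{\<omega>. balanced b \<omega>} \<in> events" using pred_balanced[of b rb rh p] by (simp add: pred_def)
  qed
  finally show ?thesis by (simp add: mult.assoc)
qed

text \<open>As the vertex 0 of the cycle stays free, no ball passes it, and the rest of the cycle
  behaves like an interval with absorbing ends. Unbounded walks ensure that each ball finds a hole,
  and the numbers of balls and holes match.\<close>

lemma block_of_cyc:
  assumes ex: "\<And>x N. \<exists>k. \<bar>walk_pos \<omega> x k - x\<bar> > int N"
    and bal: "balanced b \<omega>" and cyc: "0 \<in> cyc (2 * int b + 1) \<omega>"
  shows "block \<omega> 0 (2 * int b + 1)"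
proof -
  let ?N = "2 * int b + 1" and ?H = "{x. st \<omega> x = Hole}"
  let ?I = "{0<..<?N}"
  have 0: "st \<omega> 0 = Hole" using cyc proc_subset unfolding cyc_def by blast
  \<comment> \<open>Both ends 0 and \<open>?N\<close> of the interval are the vertex 0 of the cycle,
    hence the separating set \<open>{0}\<close>.\<close>
  have via: "exits_via (\<lambda>k. walk_pos \<omega> x k mod ?N) (walk_pos \<omega> x) ?I {0}" if "x \<in> ?I" for x
    unfolding exits_via_def
  proof (intro allI impI)
    fix k assume *: "\<forall>j<k. walk_pos \<omega> x j mod ?N = walk_pos \<omega> x j \<and> walk_pos \<omega> x j \<in> ?I"
    have "walk_pos \<omega> x k \<in> {0..?N}"
    proof (cases k)
      case (Suc m)
      then have "walk_pos \<omega> x m \<in> ?I" using * by blast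
      then show ?thesis using Suc walk_pos_Suc[of \<omega> x m] by auto
    qed (use that in auto)
    then have "walk_pos \<omega> x k \<in> ?I \<or> walk_pos \<omega> x k = 0 \<or> walk_pos \<omega> x k = ?N" by auto
    then show "walk_pos \<omega> x k mod ?N = walk_pos \<omega> x k \<and> walk_pos \<omega> x k \<in> ?I \<or>
         walk_pos \<omega> x k mod ?N \<in> {0} \<and> walk_pos \<omega> x k \<notin> ?I" by auto
  qed
  have ord: "x \<in> ?I" if "x \<in> set (order_of \<omega> {0..<?N})" for x
  proof -
    have "x \<noteq> 0" using that 0 by (auto simp: set_order_of active_def)
    then show ?thesis using that by (auto simp: set_order_of)
  qed
  have F: "?H \<inter> {0..<?N} \<inter> ?I = ?H \<inter> ?I" "{0..<?N} \<inter> ?I = ?I \<inter> ?I" by auto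
  have "({0} \<subseteq> cyc ?N \<omega> \<longleftrightarrow> (\<forall>I\<in>{?I}. - I \<subseteq> proc (walk_pos \<omega>) (filter (\<lambda>x. x \<in> I) (order_of \<omega> {0..<?N}))
       (?H \<inter> {0..<?N} \<inter> I \<union> - I)))"
    unfolding cyc_def
    by (rule proc_local[THEN conjunct1]) (use 0 via ord in \<open>auto simp: disjoint_def\<close>)
  then have "- ?I \<subseteq> proc (walk_pos \<omega>) (filter (\<lambda>x. x \<in> ?I) (order_of \<omega> {0..<?N})) (?H \<inter> {0..<?N} \<inter> ?I \<union> - ?I)"
    using cyc by blast
  then have conf: "- ?I \<subseteq> loc \<omega> ?I ?I"
    unfolding filter_order_of[OF finite_atLeastLessThan_int] F loc_def .
  \<comment> \<open>Without the hole at 0 there remain \<open>b\<close> holes and \<open>b\<close>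
    balls in the interval; each ball fills one of the holes, so none is left.\<close>
  have "card (loc \<omega> ?I ?I \<inter> ?I) + length (order_of \<omega> (?I \<inter> ?I)) = card ((?H \<inter> ?I \<union> - ?I) \<inter> ?I)"
    unfolding loc_def
  proof (rule card_proc_eq)
    fix x assume "x \<in> set (order_of \<omega> (?I \<inter> ?I))"
    then have x: "x \<in> ?I" by (simp add: set_order_of)
    obtain k where "\<bar>walk_pos \<omega> x k - x\<bar> > int (2 * b + 1)" using ex by blast
    then show "\<exists>k. walk_pos \<omega> x k \<notin> ?I" using x by (intro exI[of _ k]) auto
  qed (use conf in \<open>auto simp: loc_def\<close>)
  moreover have "(?H \<inter> ?I \<union> - ?I) \<inter> ?I = {x \<in> {0..<?N}. st \<omega> x = Hole} - {0}" by auto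
  moreover have "{x \<in> ?I. active \<omega> x} = {x \<in> {0..<?N}. active \<omega> x}"
  proof -
    have "\<not> active \<omega> 0" using 0 by (simp add: active_def)
    then show ?thesis by (auto simp: order.order_iff_strict)
  qed
  moreover have "card ({x \<in> {0..<?N}. st \<omega> x = Hole} - {0}) = b"
    using bal 0 by (subst card_Diff_singleton) (auto simp: balanced_def)
  ultimately have "card (loc \<omega> ?I ?I \<inter> ?I) = 0"
    using bal by (simp add: length_order_of balanced_def)
  then have "loc \<omega> ?I ?I \<inter> ?I = {}" by simp
  then show ?thesis unfolding block_def using 0 conf confined_finite[of ?I \<omega>] by auto
qed

text \<open>Arrange \<open>b\<close> balls and \<open>b + 1\<close> holes on a cycle of length \<open>2 * b + 1\<close>: some hole remains free, and by
  rotation invariance each vertex is equally likely to be such a hole; cutting the cycle there gives a block.\<close>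
lemma measure_block_ge:
  assumes "0 \<le> rb" "rb < 1" "rb + rh = 1" "0 \<le> p" "p \<le> 1"
  shows "catalan b * (rb * rh) ^ b * rh \<le> measure (golf_space rb rh p) {\<omega>. block \<omega> 0 (2 * int b + 1)}"
proof -
  interpret prob_space "golf_space rb rh p" by (rule prob_space_golf)
  let ?N = "2 * int b + 1"
  let ?V = "\<lambda>c. {\<omega>. c \<in> cyc ?N \<omega> \<and> balanced b \<omega>}"
  have mV: "?V c \<in> events" for c
  proof -
    have "Measurable.pred (golf_space rb rh p) (\<lambda>\<omega>. c \<in> cyc ?N \<omega> \<and> balanced b \<omega>)" by measurable
    then show ?thesis by (simp add: pred_def)
  qed
  have V: "prob (?V c) = prob (?V 0)" if "c \<in> {0..<?N}" for c
  proof -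
    \<comment> \<open>Rotation by \<open>c\<close> carries 0 to \<open>c\<close>; the law is
      invariant by \<open>golf_reindex\<close>, and \<open>cyc_rot\<close> applies outside the null
      set of tied clocks.\<close>
    have "prob (?V 0) = prob {\<omega>. 0 \<in> cyc ?N (\<lambda>x. \<omega> (rot ?N c x)) \<and> balanced b (\<lambda>x. \<omega> (rot ?N c x))}"
      by (rule golf_reindex[symmetric, where Q = "\<lambda>\<omega>. 0 \<in> cyc ?N \<omega> \<and> balanced b \<omega>"])
         (auto intro: inj_rot)
    also have "\<dots> = prob (?V c)"
    proof (rule finite_measure_eq_AE)
      have "AE \<omega> in golf_space rb rh p. inj (clock \<omega>)" by (rule AE_inj_clock)
      then show "AE \<omega> in golf_space rb rh p.
        (\<omega> \<in> {\<omega>. 0 \<in> cyc ?N (\<lambda>x. \<omega> (rot ?N c x)) \<and> balanced b (\<lambda>x. \<omega> (rot ?N c x))}) = (\<omega> \<in> ?V c)"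
      proof eventually_elim
        case (elim \<omega>)
        have "rot ?N c 0 = c" using that by (simp add: rot_def)
        then have "0 \<in> cyc ?N (\<lambda>x. \<omega> (rot ?N c x)) \<longleftrightarrow> c \<in> cyc ?N \<omega>"
          using cyc_rot[OF _ elim, of ?N c] inj_image_mem_iff[OF inj_rot[of ?N c], of 0] by simp
        then show ?case by (simp add: balanced_rot)
      qed
      show "{\<omega>. 0 \<in> cyc ?N (\<lambda>x. \<omega> (rot ?N c x)) \<and> balanced b (\<lambda>x. \<omega> (rot ?N c x))} \<in> events"
      proof -
        have "Measurable.pred (golf_space rb rh p) (\<lambda>\<omega>. 0 \<in> cyc ?N \<omega> \<and> balanced b \<omega>)" by measurable
        from measurable_compose[OF measurable_golf_reindex this, of "rot ?N c"] show ?thesis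
          by (simp add: pred_def)
      qed
    qed (rule mV)
    finally show ?thesis by simp
  qed
  have "real ((2 * b + 1) choose b) * rb ^ b * rh ^ (b + 1) \<le> prob {\<omega>. balanced b \<omega>}"
    by (rule measure_balanced_ge[OF assms(1-3)])
  also have "\<dots> \<le> prob (\<Union>c\<in>{0..<?N}. ?V c)"
    by (rule finite_measure_mono) (use cyc_nonempty mV in auto)
  also have "\<dots> \<le> (\<Sum>c\<in>{0..<?N}. prob (?V c))"
    by (rule finite_measure_subadditive_finite) (use mV in auto)
  also have "\<dots> = (\<Sum>c\<in>{0..<?N}. prob (?V 0))"
    by (intro sum.cong refl V)
  also have "\<dots> = (2 * real b + 1) * prob (?V 0)" by simp
  also have "\<dots> \<le> (2 * real b + 1) * prob {\<omega>. block \<omega> 0 ?N}"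
  proof (intro mult_left_mono)
    show "prob (?V 0) \<le> prob {\<omega>. block \<omega> 0 ?N}"
    proof (rule finite_measure_mono_AE)
    show "AE \<omega> in golf_space rb rh p. \<omega> \<in> ?V 0 \<longrightarrow> \<omega> \<in> {\<omega>. block \<omega> 0 ?N}"
      using AE_walk_exits[OF assms(4,5)] by eventually_elim (auto intro: block_of_cyc)
    show "{\<omega>. block \<omega> 0 ?N} \<in> events" using pred_block[where a = 0 and d = ?N] by (simp add: pred_def)
    qed
  qed simp
  finally have "real ((2 * b + 1) choose b) * rb ^ b * rh ^ (b + 1) \<le> (2 * real b + 1) * prob {\<omega>. block \<omega> 0 ?N}"
    by simp
  \<comment> \<open>The factor \<open>2 * b + 1\<close> is the number of vertices at which the cycle
    may be cut, and cancels against the union bound above.\<close>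
  moreover have "real ((2 * b + 1) choose b) = (2 * real b + 1) * catalan b"
  proof -
    have "Suc b * (Suc (2 * b) choose Suc b) = Suc (2 * b) * (2 * b choose b)"
      using Suc_times_binomial_eq[of "2 * b" b] by (simp only: mult.commute)
    moreover have "(Suc (2 * b) choose Suc b) = (2 * b + 1 choose b)"
      using binomial_symmetric[of b "2 * b + 1"] by simp
    ultimately have "real (Suc b) * real (2 * b + 1 choose b) = real (Suc (2 * b)) * real (2 * b choose b)"
      by (metis of_nat_mult)
    then show ?thesis by (simp add: catalan_def field_simps)
  qed
  ultimately have "(2 * real b + 1) * (catalan b * (rb * rh) ^ b * rh) \<le> (2 * real b + 1) * prob {\<omega>. block \<omega> 0 ?N}"
    by (simp add: power_mult_distrib ac_simps)
  then show ?thesis by (rule mult_left_le_imp_le) simp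
qed

section \<open>Density of free holes\<close>

text \<open>A window with \<open>2 * n + 1\<close> vertices keeps at least (holes minus balls) free holes, and by monotonicity and
  shift invariance each vertex at distance at least \<open>m\<close> from its boundary is one of them with probability at
  most that of the vertex \<open>0\<close> in the window of radius \<open>m\<close>; let \<open>n\<close> tend to infinity.\<close>
lemma H1_density_ge_window:
  assumes "0 \<le> rb" "rb < 1" "rb + rh = 1"
  shows "rh - rb \<le> measure (golf_space rb rh p) {\<omega>. 0 \<in> loc \<omega> UNIV {- int m..int m}}"
proof -
  interpret prob_space "golf_space rb rh p" by (rule prob_space_golf)
  let ?M = "golf_space rb rh p"
  define f where "f = prob {\<omega>. 0 \<in> loc \<omega> UNIV {- int m..int m}}"
  have ev: "{\<omega>. P \<omega>} \<in> events" if "Measurable.pred ?M P" for P using that by (simp add: pred_def)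
  have win: "prob {\<omega>. x \<in> loc \<omega> UNIV {x - int m..x + int m}} = f" for x
  proof -
    have "(0 \<in> loc (\<lambda>y. \<omega> (y + x)) UNIV {- int m..int m}) \<longleftrightarrow> x \<in> loc \<omega> UNIV {x - int m..x + int m}" for \<omega>
    proof -
      have "surj (\<lambda>y. y + x)" by (rule surjI[of _ "\<lambda>y. y - x"]) simp
      moreover have "(\<lambda>y. y + x) ` {- int m..int m} = {x - int m..x + int m}"
        using image_add_atLeastAtMost'[of x "- int m" "int m"] by (simp add: ac_simps)
      ultimately show ?thesis by (subst loc_shift) (auto simp: image_iff add.commute)
    qed
    then show ?thesis
      using golf_reindex[where f = "\<lambda>y. y + x" and Q = "\<lambda>\<omega>. 0 \<in> loc \<omega> UNIV {- int m..int m}" and rb = rb and rh = rh and p = p]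
      by (simp add: f_def)
  qed
  \<comment> \<open>Comparison of expected numbers in a window of radius \<open>n\<close>; the
    right-hand side accounts for the vertices near its boundary.\<close>
  have main: "(2 * real n + 1) * (rh - rb - f) \<le> 2 * real m" for n
  proof -
    let ?J = "{- int n..int n}"
    have count: "card {x \<in> ?J. st \<omega> x = Hole} \<le> card {x \<in> ?J. x \<in> loc \<omega> UNIV ?J} + card {x \<in> ?J. active \<omega> x}" for \<omega>
      using card_proc_ge[of ?J "{x. st \<omega> x = Hole}" "walk_pos \<omega>" "order_of \<omega> ?J"]
      by (simp add: loc_UNIV length_order_of Int_def conj_commute)
    have ind: "(\<Sum>x\<in>?J. indicat_real (S x) \<omega>) = real (card {x \<in> ?J. \<omega> \<in> S x})" for S and \<omega> :: "int \<Rightarrow> site"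
      by (simp add: indicator_def sum.If_cases Int_def)
    have "(\<Sum>x\<in>?J. indicator {\<omega>. st \<omega> x = Hole} \<omega>) \<le>
       (\<Sum>x\<in>?J. indicator {\<omega>. x \<in> loc \<omega> UNIV ?J} \<omega>) + (\<Sum>x\<in>?J. indicat_real {\<omega>. active \<omega> x} \<omega>)" for \<omega>
      unfolding ind mem_Collect_eq of_nat_add[symmetric] of_nat_le_iff by (rule count)
    then have "(\<integral>\<omega>. (\<Sum>x\<in>?J. indicator {\<omega>. st \<omega> x = Hole} \<omega>) \<partial>?M) \<le>
       (\<integral>\<omega>. (\<Sum>x\<in>?J. indicator {\<omega>. x \<in> loc \<omega> UNIV ?J} \<omega>) + (\<Sum>x\<in>?J. indicat_real {\<omega>. active \<omega> x} \<omega>) \<partial>?M)"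
      by (intro integral_mono Bochner_Integration.integrable_add Bochner_Integration.integrable_sum
          integrable_real_indicator ev) (auto simp: emeasure_eq_measure)
    also have "\<dots> = (\<Sum>x\<in>?J. prob {\<omega>. x \<in> loc \<omega> UNIV ?J}) + (\<Sum>x\<in>?J. prob {\<omega>. active \<omega> x})"
      by (subst Bochner_Integration.integral_add)
         (auto simp: Bochner_Integration.integral_sum integrable_real_indicator ev emeasure_eq_measure
           intro!: Bochner_Integration.integrable_sum)
    also have "(\<integral>\<omega>. (\<Sum>x\<in>?J. indicat_real {\<omega>. st \<omega> x = Hole} \<omega>) \<partial>?M) = (\<Sum>x\<in>?J. prob {\<omega>. st \<omega> x = Hole})"
      by (subst Bochner_Integration.integral_sum) (auto simp: integrable_real_indicator ev emeasure_eq_measure)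
    finally have "(2 * real n + 1) * rh \<le> (\<Sum>x\<in>?J. prob {\<omega>. x \<in> loc \<omega> UNIV ?J}) + (2 * real n + 1) * rb"
      by (simp add: measure_hole[OF assms] measure_active[OF assms])
    also have "(\<Sum>x\<in>?J. prob {\<omega>. x \<in> loc \<omega> UNIV ?J})
        \<le> (\<Sum>x\<in>?J. f + (if {x - int m..x + int m} \<subseteq> ?J then 0 else 1))"
    proof (rule sum_mono)
      fix x
      show "prob {\<omega>. x \<in> loc \<omega> UNIV ?J} \<le> f + (if {x - int m..x + int m} \<subseteq> ?J then 0 else 1)"
      proof (cases "{x - int m..x + int m} \<subseteq> ?J")
        case True
        then have "prob {\<omega>. x \<in> loc \<omega> UNIV ?J} \<le> prob {\<omega>. x \<in> loc \<omega> UNIV {x - int m..x + int m}}"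
          using loc_antimono[OF True] by (intro finite_measure_mono ev) auto
        then show ?thesis unfolding if_P[OF True] win by simp
      next
        case False
        have "f \<ge> 0" by (simp add: f_def)
        moreover have "prob {\<omega>. x \<in> loc \<omega> UNIV ?J} \<le> 1" by (rule prob_le_1)
        ultimately show ?thesis unfolding if_not_P[OF False] by linarith
      qed
    qed
    also have "\<dots> = (2 * real n + 1) * f + real (card {x \<in> ?J. \<not> {x - int m..x + int m} \<subseteq> ?J})"
      by (simp add: sum.distrib sum.If_cases Int_def)
    \<comment> \<open>At each end of the window, \<open>m\<close> vertices are too close to the
      boundary; their probabilities are estimated by 1.\<close>
    also have "card {x \<in> ?J. \<not> {x - int m..x + int m} \<subseteq> ?J} \<le> card ({- int n..< int m - int n} \<union> {int n - int m<..int n})"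
      by (rule card_mono) auto
    also have "\<dots> \<le> card {- int n..< int m - int n} + card {int n - int m<..int n}" by (rule card_Un_le)
    also have "\<dots> = 2 * m" by simp
    finally show ?thesis by (simp add: algebra_simps)
  qed
  \<comment> \<open>The bound in \<open>main\<close> does not grow with \<open>n\<close>, so the
    coefficient of \<open>2 * real n + 1\<close> cannot be positive.\<close>
  have "rh - rb \<le> f"
  proof (rule ccontr)
    assume "\<not> rh - rb \<le> f"
    then have pos: "rh - rb - f > 0" by simp
    obtain n :: nat where "2 * real m / (rh - rb - f) < real n" using reals_Archimedean2 by blast
    then have "2 * real m < real n * (rh - rb - f)" using pos by (simp add: field_simps)
    also have "\<dots> \<le> (2 * real n + 1) * (rh - rb - f)" using pos by (intro mult_right_mono) auto
    finally show False using main[of n] by simp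
  qed
  then show ?thesis by (simp add: f_def)
qed

lemma H1_density_ge:
  assumes "0 \<le> rb" "rb < 1" "rb + rh = 1"
  shows "rh - rb \<le> measure (golf_space rb rh p) {\<omega>. 0 \<in> H1 \<omega>}"
proof -
  interpret prob_space "golf_space rb rh p" by (rule prob_space_golf)
  let ?A = "\<lambda>m. {\<omega>. 0 \<in> loc \<omega> UNIV {- int m..int m}}"
  have "(\<lambda>m. prob (?A m)) \<longlonglongrightarrow> prob (\<Inter>m. ?A m)"
  proof (rule finite_Lim_measure_decseq)
    have "?A m \<in> events" for m
      using pred_loc[where y = 0 and I = UNIV and A = "{- int m..int m}"] by (simp add: pred_def)
    then show "range ?A \<subseteq> events" by auto
    show "decseq ?A"
      unfolding decseq_def
    proof (intro allI impI)
      fix m n :: nat assume "m \<le> n"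
      then have "loc \<omega> UNIV {- int n..int n} \<subseteq> loc \<omega> UNIV {- int m..int m}" for \<omega>
        by (intro loc_antimono) auto
      then show "?A n \<subseteq> ?A m" by blast
    qed
  qed
  moreover have "(\<Inter>m. ?A m) = {\<omega>. 0 \<in> H1 \<omega>}" by (auto simp: H1_iff_nat)
  ultimately have "(\<lambda>m. prob (?A m)) \<longlonglongrightarrow> prob {\<omega>. 0 \<in> H1 \<omega>}" by simp
  then show ?thesis
    by (rule LIMSEQ_le_const) (use H1_density_ge_window[OF assms] in blast)
qed

section \<open>Generating functions\<close>

lemma catalan_Suc: "real (k + 2) * catalan (Suc k) = 2 * real (2 * k + 1) * catalan k"
proof -
  have e: "Suc (2 * k + 1) = 2 * Suc k" by simp
  have "Suc k * (2 * Suc k choose Suc k) = Suc k * (2 * (2 * k + 1 choose k))"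
    using Suc_times_binomial_eq[of "2 * k + 1" k] unfolding e by (simp only: ac_simps)
  then have a: "(2 * Suc k choose Suc k) = 2 * (2 * k + 1 choose k)"
    by (simp only: mult_cancel1) simp
  have b: "real (k + 1) * real (2 * k + 1 choose k) = real (2 * k + 1) * real (2 * k choose k)"
  proof -
    have "Suc k * (Suc (2 * k) choose Suc k) = Suc (2 * k) * (2 * k choose k)"
      using Suc_times_binomial_eq[of "2 * k" k] by (simp only: mult.commute)
    moreover have "(Suc (2 * k) choose Suc k) = (2 * k + 1 choose k)"
      using binomial_symmetric[of k "2 * k + 1"] by simp
    ultimately show ?thesis unfolding of_nat_mult[symmetric] of_nat_eq_iff by (simp only: Suc_eq_plus1)
  qed
  have "real (k + 2) * catalan (Suc k) = 2 * real (2 * k + 1 choose k)"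
    unfolding catalan_def a by simp
  also have "\<dots> = 2 * (real (2 * k + 1) * real (2 * k choose k) / real (k + 1))"
    unfolding b[symmetric] by (simp del: binomial_Suc_Suc)
  finally show ?thesis by (simp add: catalan_def)
qed

text \<open>These are the coefficients of \<open>sqrt (1 - 4 * x)\<close>, which equals one minus
  \<open>2 * x\<close> times the Catalan generating function.\<close>

lemma gbinomial_half_catalan: "((1/2 :: real) gchoose Suc k) * (- 4) ^ Suc k = - 2 * catalan k"
proof (induction k)
  case 0
  then show ?case by (simp add: catalan_def)
next
  case (Suc k)
  have "((1/2 :: real) gchoose Suc (Suc k)) * (- 4) ^ Suc (Suc k)
     = ((1/2 gchoose Suc k) * (- 4) ^ Suc k) * ((1/2 - real (Suc k)) / real (Suc (Suc k)) * (- 4))"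
    by (subst gbinomial_Suc_rec) simp
  also have "\<dots> = - 2 * (2 * real (2 * k + 1) * catalan k / real (k + 2))"
    unfolding Suc by (simp add: field_simps)
  also have "2 * real (2 * k + 1) * catalan k / real (k + 2) = catalan (Suc k)"
    using catalan_Suc[of k] by (simp add: field_simps)
  finally show ?case .
qed

text \<open>Likewise for \<open>1 / sqrt (1 - 4 * x)\<close>, which equals one plus
  \<open>2 * x\<close> times the series defining \<open>Hfun\<close>.\<close>

lemma gbinomial_minus_half_catalan:
  "((- 1/2 :: real) gchoose Suc k) * (- 4) ^ Suc k = 2 * (real (2 * k + 1) * catalan k)"
proof (induction k)
  case 0
  then show ?case by (simp add: catalan_def)
next
  case (Suc k)
  have "((- 1/2 :: real) gchoose Suc (Suc k)) * (- 4) ^ Suc (Suc k)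
     = ((- 1/2 gchoose Suc k) * (- 4) ^ Suc k) * ((- 1/2 - real (Suc k)) / real (Suc (Suc k)) * (- 4))"
    by (subst gbinomial_Suc_rec) simp
  also have "\<dots> = 2 * real (2 * k + 3) * (2 * real (2 * k + 1) * catalan k / real (k + 2))"
    unfolding Suc by (simp add: field_simps)
  also have "2 * real (2 * k + 1) * catalan k / real (k + 2) = catalan (Suc k)"
    using catalan_Suc[of k] by (simp add: field_simps)
  finally show ?case by simp
qed

lemma sums_catalan:
  assumes "0 \<le> rb" "rb + rh = 1" "rb < rh"
  shows "(\<lambda>k. catalan k * (rb * rh) ^ k) sums (1 / rh)"
    and "(\<lambda>k. real (2 * k + 1) * catalan k * (rb * rh) ^ k) sums (1 / (rh * (rh - rb)))"
proof -
  have rh: "rh = 1 - rb" "rh > 0" using assms by auto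
  \<comment> \<open>Because \<open>rb + rh = 1\<close>, the discriminant is a square, and
    \<open>rb < rh\<close> selects its root \<open>rh - rb\<close>; this is why both series have
    rational values in \<open>rb\<close> and \<open>rh\<close>.\<close>
  have sq: "1 + - 4 * (rb * rh) = (rh - rb)\<^sup>2" by (simp add: rh power2_eq_square algebra_simps)
  have "\<bar>- 4 * (rb * rh)\<bar> < 1"
  proof -
    have "(rh - rb)\<^sup>2 > 0" using assms by simp
    then have "4 * (rb * rh) < 1" using sq by linarith
    moreover have "0 \<le> rb * rh" using assms(1) rh(2) by simp
    ultimately show ?thesis by linarith
  qed
  note bin = gen_binomial_real[OF this, unfolded sq]
  have powr: "((rh - rb)\<^sup>2) powr (1/2) = rh - rb" "((rh - rb)\<^sup>2) powr (- 1/2) = 1 / (rh - rb)"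
    using assms by (simp_all add: powr_half_sqrt powr_minus_divide)
  have shift: "(\<lambda>k. (a gchoose Suc k) * (- 4) ^ Suc k * (rb * rh) ^ Suc k) sums (((rh - rb)\<^sup>2) powr a - 1)" for a
  proof (subst sums_Suc_iff)
    have "(- 4 * (rb * rh)) ^ k = (- 4) ^ k * (rb * rh) ^ k" for k by (rule power_mult_distrib)
    then show "(\<lambda>k. (a gchoose k) * (- 4) ^ k * (rb * rh) ^ k) sums
        (((rh - rb)\<^sup>2) powr a - 1 + (a gchoose 0) * (- 4) ^ 0 * (rb * rh) ^ 0)"
      using bin[of a] by (simp only: mult.assoc gbinomial_0 power_0 mult_1 diff_add_cancel)
  qed
  show "(\<lambda>k. catalan k * (rb * rh) ^ k) sums (1 / rh)"
  \<comment> \<open>The closed forms divide by \<open>rb * rh\<close>; for \<open>rb = 0\<close>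
    only the term of index 0 survives.\<close>
  proof (cases "rb = 0")
    case True
    then show ?thesis using sums_If_finite_set[of "{0}" "\<lambda>_. 1 :: real"] rh
      by (simp add: power_0_left catalan_def if_distrib cong: if_cong)
  next
    case False
    have "(\<lambda>k. - 1 / (2 * rb * rh) * (- 2 * catalan k * (rb * rh) ^ Suc k)) sums (- 1 / (2 * rb * rh) * (rh - rb - 1))"
      using shift[of "1/2"] unfolding gbinomial_half_catalan powr by (rule sums_mult)
    moreover have "- 1 / (2 * rb * rh) * (rh - rb - 1) = 1 / rh"
    proof -
      have "rh - rb - 1 = - 2 * rb" using rh by simp
      then show ?thesis unfolding \<open>rh - rb - 1 = - 2 * rb\<close> using False by simp
    qed
    moreover have "- 1 / (2 * rb * rh) * (- 2 * catalan k * (rb * rh) ^ Suc k) = catalan k * (rb * rh) ^ k" for k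
      using False rh(2) by simp
    ultimately show ?thesis by (simp only:)
  qed
  show "(\<lambda>k. real (2 * k + 1) * catalan k * (rb * rh) ^ k) sums (1 / (rh * (rh - rb)))"
  proof (cases "rb = 0")
    case True
    then show ?thesis using sums_If_finite_set[of "{0}" "\<lambda>_. 1 :: real"] rh
      by (simp add: power_0_left catalan_def if_distrib cong: if_cong)
  next
    case False
    have "(\<lambda>k. 1 / (2 * rb * rh) * (2 * (real (2 * k + 1) * catalan k) * (rb * rh) ^ Suc k)) sums
        (1 / (2 * rb * rh) * (1 / (rh - rb) - 1))"
      using shift[of "- 1/2"] unfolding gbinomial_minus_half_catalan powr by (rule sums_mult)
    moreover have "1 / (2 * rb * rh) * (1 / (rh - rb) - 1) = 1 / (rh * (rh - rb))"
    proof -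
      have "1 / (rh - rb) - 1 = 2 * rb / (rh - rb)" using assms rh by (simp add: field_simps)
      then show ?thesis using False by simp
    qed
    moreover have "1 / (2 * rb * rh) * (2 * (real (2 * k + 1) * catalan k) * (rb * rh) ^ Suc k)
        = real (2 * k + 1) * catalan k * (rb * rh) ^ k" for k
      using False rh(2) by simp
    ultimately show ?thesis by (simp only:)
  qed
qed

lemma Gfun_Hfun:
  assumes "0 \<le> rb" "rb + rh = 1" "rb < rh"
  shows "Gfun (rb * rh) = 1 / rh" "Hfun (rb * rh) = 1 / (rh * (rh - rb))"
  using sums_catalan[OF assms] by (simp_all add: Gfun_def Hfun_def sums_iff)

section \<open>Gaps between free holes\<close>

text \<open>Disjoint events whose lower bounds have total mass one leave no room for strict inequality.\<close>
lemma (in prob_space) prob_eq_prod_of_ge: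
  fixes g :: "'i \<Rightarrow> nat \<Rightarrow> real"
  assumes J: "finite J"
    and meas: "\<And>b. T b \<in> events"
    and disj: "\<And>b b'. b \<in> J \<rightarrow>\<^sub>E UNIV \<Longrightarrow> b' \<in> J \<rightarrow>\<^sub>E UNIV \<Longrightarrow> b \<noteq> b' \<Longrightarrow> T b \<inter> T b' = {}"
    and ge: "\<And>b. (\<Prod>i\<in>J. g i (b i)) \<le> prob (T b)"
    and sums: "\<And>i. i \<in> J \<Longrightarrow> g i sums 1"
    and b: "b \<in> J \<rightarrow>\<^sub>E UNIV"
  shows "prob (T b) = (\<Prod>i\<in>J. g i (b i))"
proof (rule antisym[OF _ ge])
  \<comment> \<open>The total of the lower bounds over all families with values at most
    \<open>n\<close>; it tends to 1.\<close>
  define s where "s n = (\<Prod>i\<in>J. \<Sum>k\<le>n. g i k)" for n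
  have "s \<longlonglongrightarrow> (\<Prod>i\<in>J. 1)"
    unfolding s_def using sums by (intro tendsto_prod) (simp add: sums_def_le)
  then have "(\<lambda>n. 1 - s n + (\<Prod>i\<in>J. g i (b i))) \<longlonglongrightarrow> 1 - 1 + (\<Prod>i\<in>J. g i (b i))"
    by (intro tendsto_intros) simp
  \<comment> \<open>All other events of the box together have probability at least
    \<open>s n\<close> minus the bound for \<open>b\<close>, and disjointness leaves only the
    remainder for \<open>T b\<close>.\<close>
  moreover have "prob (T b) \<le> 1 - s n + (\<Prod>i\<in>J. g i (b i))" if n: "n \<ge> Max (insert 0 (b ` J))" for n
  proof -
    let ?B = "J \<rightarrow>\<^sub>E {..n}"
    have fin: "finite ?B" using J by (simp add: finite_PiE)
    have sub: "?B \<subseteq> J \<rightarrow>\<^sub>E UNIV" by (rule PiE_mono) simp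
    have bB: "b \<in> ?B"
      using b n J by (auto simp: PiE_iff)
    have "s n = (\<Sum>b\<in>?B. \<Prod>i\<in>J. g i (b i))"
      unfolding s_def by (rule prod_sum_PiE) (use J in auto)
    also have "\<dots> = (\<Prod>i\<in>J. g i (b i)) + (\<Sum>b\<in>?B - {b}. \<Prod>i\<in>J. g i (b i))"
      by (rule sum.remove[OF fin bB])
    also have "\<dots> \<le> (\<Prod>i\<in>J. g i (b i)) + (\<Sum>b\<in>?B - {b}. prob (T b))"
      by (intro add_left_mono sum_mono ge)
    finally have "s n \<le> (\<Prod>i\<in>J. g i (b i)) + (\<Sum>b\<in>?B - {b}. prob (T b))" .
    moreover have "prob (T b) + (\<Sum>b\<in>?B - {b}. prob (T b)) = (\<Sum>b\<in>?B. prob (T b))"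
      by (rule sum.remove[OF fin bB, symmetric])
    moreover have "(\<Sum>b\<in>?B. prob (T b)) = prob (\<Union>b\<in>?B. T b)"
    proof (rule finite_measure_finite_Union[symmetric])
      show "disjoint_family_on T ?B"
        unfolding disjoint_family_on_def using sub by (intro ballI impI disj) auto
    qed (use fin meas in auto)
    moreover have "\<dots> \<le> 1" by (rule prob_le_1)
    ultimately show ?thesis by linarith
  qed
  ultimately show "prob (T b) \<le> (\<Prod>i\<in>J. g i (b i))"
    using LIMSEQ_le_const[of _ "1 - 1 + (\<Prod>i\<in>J. g i (b i))" "prob (T b)"] by auto
qed

section \<open>The enumeration of the free holes\<close>

lemma enum_idx_unique:
  fixes S :: "int set"
  shows "h \<in> S \<Longrightarrow> h' \<in> S \<Longrightarrow> h \<le> 0 \<Longrightarrow> h' \<le> 0 \<Longrightarrow>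
      card {y\<in>S. h \<le> y \<and> y \<le> 0} = card {y\<in>S. h' \<le> y \<and> y \<le> 0} \<Longrightarrow> h = h'"
    and "h \<in> S \<Longrightarrow> h' \<in> S \<Longrightarrow> 0 < h \<Longrightarrow> 0 < h' \<Longrightarrow>
      card {y\<in>S. 0 < y \<and> y \<le> h} = card {y\<in>S. 0 < y \<and> y \<le> h'} \<Longrightarrow> h = h'"
proof -
  \<comment> \<open>Moving \<open>h\<close> away from the origin to another point of
    \<open>S\<close> strictly increases the count; so the descriptions in \<open>enum_idx\<close>
    have at most one solution.\<close>
  have neg: "card {y\<in>S. h' \<le> y \<and> y \<le> 0} < card {y\<in>S. h \<le> y \<and> y \<le> 0}"
    if "h \<in> S" "h \<le> 0" "h < h'" for h h'
  proof (rule psubset_card_mono)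
    show "finite {y\<in>S. h \<le> y \<and> y \<le> 0}" by (rule finite_subset[of _ "{h..0}"]) auto
    have "h \<in> {y\<in>S. h \<le> y \<and> y \<le> 0}" "h \<notin> {y\<in>S. h' \<le> y \<and> y \<le> 0}" using that by auto
    moreover have "{y\<in>S. h' \<le> y \<and> y \<le> 0} \<subseteq> {y\<in>S. h \<le> y \<and> y \<le> 0}" using that(3) by auto
    ultimately show "{y\<in>S. h' \<le> y \<and> y \<le> 0} \<subset> {y\<in>S. h \<le> y \<and> y \<le> 0}" by blast
  qed
  have pos: "card {y\<in>S. 0 < y \<and> y \<le> h'} < card {y\<in>S. 0 < y \<and> y \<le> h}"
    if "h \<in> S" "0 < h" "h' < h" for h h'
  proof (rule psubset_card_mono)
    show "finite {y\<in>S. 0 < y \<and> y \<le> h}" by (rule finite_subset[of _ "{0..h}"]) auto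
    have "h \<in> {y\<in>S. 0 < y \<and> y \<le> h}" "h \<notin> {y\<in>S. 0 < y \<and> y \<le> h'}" using that by auto
    moreover have "{y\<in>S. 0 < y \<and> y \<le> h'} \<subseteq> {y\<in>S. 0 < y \<and> y \<le> h}" using that(3) by auto
    ultimately show "{y\<in>S. 0 < y \<and> y \<le> h'} \<subset> {y\<in>S. 0 < y \<and> y \<le> h}" by blast
  qed
  show "h \<in> S \<Longrightarrow> h' \<in> S \<Longrightarrow> h \<le> 0 \<Longrightarrow> h' \<le> 0 \<Longrightarrow>
      card {y\<in>S. h \<le> y \<and> y \<le> 0} = card {y\<in>S. h' \<le> y \<and> y \<le> 0} \<Longrightarrow> h = h'"
    using neg[of h h'] neg[of h' h] by linarith
  show "h \<in> S \<Longrightarrow> h' \<in> S \<Longrightarrow> 0 < h \<Longrightarrow> 0 < h' \<Longrightarrow>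
      card {y\<in>S. 0 < y \<and> y \<le> h} = card {y\<in>S. 0 < y \<and> y \<le> h'} \<Longrightarrow> h = h'"
    using pos[of h h'] pos[of h' h] by linarith
qed

text \<open>Uniqueness of the described point is enough for \<open>measurable_THE\<close>. Existence
  may fail, so configurations with too few free holes are covered too.\<close>

lemma measurable_enum_idx [measurable]:
  "(\<lambda>\<omega>. enum_idx (H1 \<omega>) i) \<in> golf_space rb rh p \<rightarrow>\<^sub>M count_space UNIV"
proof (cases "i \<le> 0")
  case True
  have eq: "int (card {y\<in>S. h \<le> y \<and> y \<le> 0}) = 1 - i \<longleftrightarrow> card {y \<in> {h..0}. y \<in> S} = nat (1 - i)"
    for h and S :: "int set"
  proof -
    have "{y\<in>S. h \<le> y \<and> y \<le> 0} = {y \<in> {h..0}. y \<in> S}" by auto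
    then show ?thesis using True by (simp only:) linarith
  qed
  show ?thesis
    unfolding enum_idx_def if_P[OF True]
  proof (rule measurable_THE[where I = UNIV])
    show "Measurable.pred (golf_space rb rh p)
      (\<lambda>\<omega>. h \<in> H1 \<omega> \<and> h \<le> 0 \<and> int (card {y\<in>H1 \<omega>. h \<le> y \<and> y \<le> 0}) = 1 - i)" for h
      unfolding eq by (intro pred_intros_logic pred_card) measurable
    show "h = h'" if "h \<in> H1 \<omega> \<and> h \<le> 0 \<and> int (card {y\<in>H1 \<omega>. h \<le> y \<and> y \<le> 0}) = 1 - i"
      "h' \<in> H1 \<omega> \<and> h' \<le> 0 \<and> int (card {y\<in>H1 \<omega>. h' \<le> y \<and> y \<le> 0}) = 1 - i" for \<omega> h h'
      by (rule enum_idx_unique(1)[of _ "H1 \<omega>"]) (use that in linarith)+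
  qed auto
next
  case False
  have eq: "int (card {y\<in>S. 0 < y \<and> y \<le> h}) = i \<longleftrightarrow> card {y \<in> {0<..h}. y \<in> S} = nat i"
    for h and S :: "int set"
  proof -
    have "{y\<in>S. 0 < y \<and> y \<le> h} = {y \<in> {0<..h}. y \<in> S}" by auto
    then show ?thesis using False by (simp only:) linarith
  qed
  show ?thesis
    unfolding enum_idx_def if_not_P[OF False]
  proof (rule measurable_THE[where I = UNIV])
    show "Measurable.pred (golf_space rb rh p)
      (\<lambda>\<omega>. h \<in> H1 \<omega> \<and> 0 < h \<and> int (card {y\<in>H1 \<omega>. 0 < y \<and> y \<le> h}) = i)" for h
      unfolding eq by (intro pred_intros_logic pred_card) measurable
    show "h = h'" if "h \<in> H1 \<omega> \<and> 0 < h \<and> int (card {y\<in>H1 \<omega>. 0 < y \<and> y \<le> h}) = i"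
      "h' \<in> H1 \<omega> \<and> 0 < h' \<and> int (card {y\<in>H1 \<omega>. 0 < y \<and> y \<le> h'}) = i" for \<omega> h h'
      by (rule enum_idx_unique(2)[of _ "H1 \<omega>"]) (use that in linarith)+
  qed auto
qed

lemma pred_gap [measurable]: "Measurable.pred (golf_space rb rh p) (\<lambda>\<omega>. gap (H1 \<omega>) i = k)"
proof -
  have "gap S i = k \<longleftrightarrow> (\<exists>u v. enum_idx S (i + 1) = u \<and> enum_idx S i = v \<and> u - v - 1 = k)" for S
    by (simp add: gap_def)
  then show ?thesis by (simp only:) measurable
qed

text \<open>The index of a point depends only on the points of \<open>S\<close> between it and the
  origin. Knowing \<open>S\<close> in a window around the origin therefore determines the indices
  there, and \<open>x 0 \<le> 0 < x 1\<close> fixes the offset.\<close>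

lemma enum_idx_eq:
  assumes x: "strict_mono x" and S: "S \<inter> {x a..x d} = x ` {a..d}"
    and i: "a \<le> i" "i \<le> d" and ad: "a \<le> 0" "1 \<le> d" and 0: "x 0 \<le> 0" "0 < x 1"
  shows "enum_idx S i = (x i :: int)"
proof -
  note le = strict_mono_less_eq[OF x] and lt = strict_mono_less[OF x]
  have xi: "x i \<in> S" using S i by (metis IntD1 atLeastAtMost_iff imageI)
  have mem: "y \<in> S \<longleftrightarrow> (\<exists>j\<in>{a..d}. y = x j)" if "x a \<le> y" "y \<le> x d" for y
  proof -
    have "y \<in> S \<inter> {x a..x d} \<longleftrightarrow> y \<in> x ` {a..d}" using S by simp
    then show ?thesis using that by (simp add: image_iff)
  qed
  have a: "x a \<le> 0" "x a < x 1" using le[of a 0] lt[of a 1] 0 ad by linarith+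
  have d: "0 < x d" using le[of 1 d] 0 ad by linarith
  show ?thesis
  proof (cases "i \<le> 0")
    case True
    have "{y\<in>S. x i \<le> y \<and> y \<le> 0} = x ` {i..0}"
    proof (intro equalityI subsetI)
      fix y assume y: "y \<in> {y\<in>S. x i \<le> y \<and> y \<le> 0}"
      have "x a \<le> x i" using le[of a i] i by blast
      then have "x a \<le> y" "y \<le> x d" using y d by auto
      then obtain j where j: "j \<in> {a..d}" "y = x j" using mem[of y] y by blast
      have "x i \<le> x j" "x j < x 1" using y j(2) 0 by auto
      then have "j \<in> {i..0}" unfolding le lt by simp
      then show "y \<in> x ` {i..0}" using j(2) by blast
    next
      fix y assume "y \<in> x ` {i..0}"
      then obtain j where j: "j \<in> {i..0}" "y = x j" by blast
      then have "j \<in> {a..d}" using i ad by auto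
      then have "x j \<in> S" using S by blast
      moreover have "x i \<le> x j" "x j \<le> x 0" using j(1) unfolding le by auto
      ultimately show "y \<in> {y\<in>S. x i \<le> y \<and> y \<le> 0}" using j 0 by auto
    qed
    moreover have "card (x ` {i..0}) = nat (1 - i)"
      using card_image[OF strict_mono_imp_inj_on[OF x], of "{i..0}"] by simp
    ultimately have card: "int (card {y\<in>S. x i \<le> y \<and> y \<le> 0}) = 1 - i" using True by simp
    have "x i \<le> 0" using le[of i 0] True 0 by linarith
    show ?thesis
      unfolding enum_idx_def if_P[OF True]
    proof (rule the_equality)
      show "x i \<in> S \<and> x i \<le> 0 \<and> int (card {y\<in>S. x i \<le> y \<and> y \<le> 0}) = 1 - i"
        by (intro conjI xi card \<open>x i \<le> 0\<close>)
      show "h = x i" if "h \<in> S \<and> h \<le> 0 \<and> int (card {y\<in>S. h \<le> y \<and> y \<le> 0}) = 1 - i" for h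
        by (rule enum_idx_unique(1)[of _ S]) (use xi card \<open>x i \<le> 0\<close> that in linarith)+
    qed
  next
    case False
    have "{y\<in>S. 0 < y \<and> y \<le> x i} = x ` {1..i}"
    proof (intro equalityI subsetI)
      fix y assume y: "y \<in> {y\<in>S. 0 < y \<and> y \<le> x i}"
      have "x i \<le> x d" using le[of i d] i by blast
      then have "x a \<le> y" "y \<le> x d" using y a by auto
      then obtain j where j: "j \<in> {a..d}" "y = x j" using mem[of y] y by blast
      have "x j \<le> x i" "x 0 < x j" using y j(2) 0 by auto
      then have "j \<in> {1..i}" unfolding le lt by simp
      then show "y \<in> x ` {1..i}" using j(2) by blast
    next
      fix y assume "y \<in> x ` {1..i}"
      then obtain j where j: "j \<in> {1..i}" "y = x j" by blast
      then have "j \<in> {a..d}" using i ad by auto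
      then have "x j \<in> S" using S by blast
      moreover have "x 1 \<le> x j" "x j \<le> x i" using j(1) unfolding le by auto
      ultimately show "y \<in> {y\<in>S. 0 < y \<and> y \<le> x i}" using j 0 by auto
    qed
    moreover have "card (x ` {1..i}) = nat i"
      using card_image[OF strict_mono_imp_inj_on[OF x], of "{1..i}"] by simp
    ultimately have card: "int (card {y\<in>S. 0 < y \<and> y \<le> x i}) = i" using False by simp
    have "x 1 \<le> x i" using le[of 1 i] False by linarith
    then have "0 < x i" using 0 by linarith
    show ?thesis
      unfolding enum_idx_def if_not_P[OF False]
    proof (rule the_equality)
      show "x i \<in> S \<and> 0 < x i \<and> int (card {y\<in>S. 0 < y \<and> y \<le> x i}) = i"
        by (intro conjI xi card \<open>0 < x i\<close>)
      show "h = x i" if "h \<in> S \<and> 0 < h \<and> int (card {y\<in>S. 0 < y \<and> y \<le> h}) = i" for h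
        by (rule enum_idx_unique(2)[of _ S]) (use xi card \<open>0 < x i\<close> that in linarith)+
    qed
  qed
qed

section \<open>Factorization over blocks and half-lines\<close>

definition right_confined :: "(int \<Rightarrow> site) \<Rightarrow> int \<Rightarrow> bool" where
  "right_confined \<omega> a \<longleftrightarrow> st \<omega> a = Hole \<and> confined \<omega> {a<..}"

lemma pred_right_confined [measurable]: "Measurable.pred (golf_space rb rh p) (\<lambda>\<omega>. right_confined \<omega> a)"
  unfolding right_confined_def by measurable

lemma measure_half_line_shift:
  "measure (golf_space rb rh p) {\<omega>. confined \<omega> {..<a}} = measure (golf_space rb rh p) {\<omega>. confined \<omega> {..<0}}"
  "measure (golf_space rb rh p) {\<omega>. right_confined \<omega> a} = measure (golf_space rb rh p) {\<omega>. right_confined \<omega> 0}"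
proof -
  have im: "(\<lambda>y::int. y + a) ` {..<0} = {..<a}" "(\<lambda>y::int. y + a) ` {0<..} = {a<..}"
    by (auto intro!: image_eqI[of _ _ "_ - a"])
  show "measure (golf_space rb rh p) {\<omega>. confined \<omega> {..<a}} = measure (golf_space rb rh p) {\<omega>. confined \<omega> {..<0}}"
    using golf_reindex[where f = "\<lambda>y. y + a" and Q = "\<lambda>\<omega>. confined \<omega> {..<0}" and rb = rb and rh = rh and p = p]
    by (simp add: confined_shift im)
  have "right_confined (\<lambda>x. \<omega> (x + a)) 0 \<longleftrightarrow> right_confined \<omega> a" for \<omega>
    unfolding right_confined_def confined_shift im by (simp add: st_def)
  then show "measure (golf_space rb rh p) {\<omega>. right_confined \<omega> a} = measure (golf_space rb rh p) {\<omega>. right_confined \<omega> 0}"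
    using golf_reindex[where f = "\<lambda>y. y + a" and Q = "\<lambda>\<omega>. right_confined \<omega> 0" and rb = rb and rh = rh and p = p]
    by simp
qed

lemma right_confined_cong:
  "(\<And>x. a \<le> x \<Longrightarrow> \<omega> x = \<omega>' x) \<Longrightarrow> right_confined \<omega> a \<longleftrightarrow> right_confined \<omega>' a"
  using confined_cong[of "{a<..}" \<omega> \<omega>'] by (simp add: right_confined_def st_def)

lemma block_cong:
  "a < d \<Longrightarrow> (\<And>x. x \<in> {a..<d} \<Longrightarrow> \<omega> x = \<omega>' x) \<Longrightarrow> block \<omega> a d \<longleftrightarrow> block \<omega>' a d"
  using confined_cong[of "{a<..<d}" \<omega> \<omega>'] loc_cong[of "{a<..<d}" \<omega> \<omega>' "{a<..<d}"]
  by (simp add: block_def st_def)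

text \<open>A free hole at 0 separates the two half-lines. Their individual probabilities stay
  unknown; this product is all that \<open>measure_blocks\<close> uses.\<close>

lemma measure_H1_density:
  "measure (golf_space rb rh p) {\<omega>. 0 \<in> H1 \<omega>} =
     measure (golf_space rb rh p) {\<omega>. confined \<omega> {..<0}} * measure (golf_space rb rh p) {\<omega>. right_confined \<omega> 0}"
proof -
  have "0 \<in> H1 \<omega> \<longleftrightarrow> confined \<omega> {..<0} \<and> right_confined \<omega> 0" for \<omega>
  proof -
    have "{0} \<subseteq> H1 \<omega> \<longleftrightarrow> {0} \<subseteq> {x. st \<omega> x = Hole} \<and> (\<forall>I\<in>{{..<0}, {0<..}}. confined \<omega> I)"
      by (rule H1_decompose) (auto simp: disjoint_def)
    then show ?thesis by (auto simp: right_confined_def)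
  qed
  then have "{\<omega>. 0 \<in> H1 \<omega>} =
      {\<omega>. \<forall>j\<in>UNIV. if j then confined \<omega> {..<0} else right_confined \<omega> 0}"
    by (auto simp: UNIV_bool)
  moreover have "measure (golf_space rb rh p) {\<omega>. \<forall>j\<in>UNIV. if j then confined \<omega> {..<0} else right_confined \<omega> 0}
     = (\<Prod>j\<in>UNIV. measure (golf_space rb rh p) {\<omega>. if j then confined \<omega> {..<0} else right_confined \<omega> 0})"
  proof (rule golf_indep_blocks[where K = "\<lambda>j. if j then {..<0} else {0..}"])
    fix j :: bool and \<omega> \<omega>' :: "int \<Rightarrow> site"
    assume "\<And>x. x \<in> (if j then {..<0} else {0..}) \<Longrightarrow> \<omega> x = \<omega>' x"
    then show "(if j then confined \<omega> {..<0} else right_confined \<omega> 0) =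
        (if j then confined \<omega>' {..<0} else right_confined \<omega>' 0)"
      using confined_cong[of "{..<0}" \<omega> \<omega>'] right_confined_cong[of 0 \<omega> \<omega>'] by (cases j) simp_all
  qed (auto simp: disjoint_family_on_def)
  ultimately show ?thesis by (simp add: UNIV_bool)
qed

text \<open>The gaps and the two half-lines partition the complement of the prescribed points, so
  confinement of all of them keeps these points free; being finite and filled by its own balls, each
  gap contains no further free hole.\<close>

lemma H1_of_blocks:
  assumes x: "strict_mono x" and ad: "a < d"
    and left: "confined \<omega> {..<x a}" and right: "right_confined \<omega> (x d)"
    and blocks: "\<And>j. j \<in> {a..<d} \<Longrightarrow> block \<omega> (x j) (x (j + 1))"
  shows "H1 \<omega> \<inter> {x a..x d} = x ` {a..(d::int)}"
proof -
  note le = strict_mono_less_eq[OF x] and lt = strict_mono_less[OF x]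
  let ?X = "x ` {a..d}" and ?I = "\<lambda>j. {x j<..<x (j + 1)}"
  let ?\<I> = "insert {..<x a} (insert {x d<..} (?I ` {a..<d}))"
  have find: "\<exists>k\<in>{a..<j}. x k \<le> y \<and> y < x (k + 1)" if "a \<le> j" "x a \<le> y" "y < x j" for j y
    using that(1,3)
  proof (induction j rule: int_ge_induct)
    case base
    then show ?case using that(2) by simp
  next
    case (step j)
    show ?case
    proof (cases "y < x j")
      case True
      then obtain k where "k \<in> {a..<j}" "x k \<le> y" "y < x (k + 1)" using step.IH by blast
      then show ?thesis by (intro bexI[of _ k]) auto
    next
      case False
      then show ?thesis using step by (intro bexI[of _ j]) auto
    qed
  qed
  have mid: "x a \<le> x j" "x (j + 1) \<le> x d" if "j \<in> {a..<d}" for j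
    using that by (auto simp: le)
  have xad: "x a \<le> x d" using ad by (simp add: le)
  have notX: "y \<notin> ?X" if "j \<in> {a..<d}" "y \<in> ?I j" for j y
  proof
    assume "y \<in> ?X"
    then obtain k where "y = x k" by blast
    then have "x j < x k" "x k < x (j + 1)" using that(2) by auto
    then show False unfolding lt by simp
  qed
  have ends: "x a \<in> ?X" "x d \<in> ?X" using ad by auto
  have X: "x a \<le> y \<and> y \<le> x d" if "y \<in> ?X" for y
    using that by (auto simp: le)
  have cover: "\<Union>?\<I> = - ?X"
  proof (intro equalityI subsetI)
    fix y assume "y \<in> \<Union>?\<I>"
    then consider "y < x a" | "x d < y" | j where "j \<in> {a..<d}" "y \<in> ?I j" by auto
    then show "y \<in> - ?X"
    proof cases
      case 1 then show ?thesis using X[of y] by auto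
    next
      case 2 then show ?thesis using X[of y] by auto
    next
      case 3 then show ?thesis using notX by blast
    qed
  next
    fix y assume y: "y \<in> - ?X"
    show "y \<in> \<Union>?\<I>"
    proof (cases "y < x a \<or> x d < y")
      case True
      then show ?thesis by auto
    next
      case False
      then have "x a \<le> y" "y < x d" using y ends by (auto simp: order_less_le)
      then obtain k where k: "k \<in> {a..<d}" "x k \<le> y" "y < x (k + 1)" using find[of d y] ad by auto
      have "x k \<in> ?X" using k(1) by auto
      then have "y \<in> ?I k" using k y by (auto simp: order_less_le)
      then show ?thesis using k(1) by blast
    qed
  qed
  have disj: "disjoint ?\<I>"
  proof -
    have "A = B" if "A \<in> ?\<I>" "B \<in> ?\<I>" "y \<in> A" "y \<in> B" for A B y
    proof -
      have same: "j = j'" if "y \<in> ?I j" "y \<in> ?I j'" for j j'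
      proof -
        have "x j < x (j' + 1)" "x j' < x (j + 1)" using that by auto
        then show ?thesis unfolding lt by simp
      qed
      have in_mid: "x a < y \<and> y < x d" if "j \<in> {a..<d}" "y \<in> ?I j" for j
        using mid[OF that(1)] that(2) by auto
      have A: "(A = {..<x a} \<and> y < x a) \<or> (A = {x d<..} \<and> x d < y) \<or> (\<exists>j\<in>{a..<d}. A = ?I j \<and> y \<in> ?I j)"
        using that(1,3) by auto
      have B: "(B = {..<x a} \<and> y < x a) \<or> (B = {x d<..} \<and> x d < y) \<or> (\<exists>j\<in>{a..<d}. B = ?I j \<and> y \<in> ?I j)"
        using that(2,4) by auto
      consider "y < x a" | "x d < y" | "x a \<le> y" "y \<le> x d" by linarith
      then show ?thesis
      proof cases
        case 1
        then have "\<not> x d < y" "\<And>j. j \<in> {a..<d} \<Longrightarrow> y \<notin> ?I j" using in_mid xad by force+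
        then show ?thesis using A B by blast
      next
        case 2
        then have "\<not> y < x a" "\<And>j. j \<in> {a..<d} \<Longrightarrow> y \<notin> ?I j" using in_mid xad by force+
        then show ?thesis using A B by blast
      next
        case 3
        then have "\<not> y < x a" "\<not> x d < y" by auto
        then obtain j j' where j: "A = ?I j" "y \<in> ?I j" "B = ?I j'" "y \<in> ?I j'"
          using A B by blast
        then show ?thesis using same[OF j(2,4)] by simp
      qed
    qed
    then show ?thesis unfolding disjoint_def by blast
  qed
  have nb: "y + 1 \<in> I \<union> ?X \<and> y - 1 \<in> I \<union> ?X" if I: "I \<in> ?\<I>" and y: "y \<in> I" for I y
  proof -
    consider "I = {..<x a}" | "I = {x d<..}" | j where "j \<in> {a..<d}" "I = ?I j" using I by blast
    then show ?thesis
    proof cases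
      case 1
      then have "y + 1 \<in> I \<or> y + 1 = x a" "y - 1 \<in> I" using that(2) by auto
      then show ?thesis using ends by auto
    next
      case 2
      then have "y - 1 \<in> I \<or> y - 1 = x d" "y + 1 \<in> I" using that(2) by auto
      then show ?thesis using ends by auto
    next
      case 3
      then have "y + 1 \<in> I \<or> y + 1 = x (j + 1)" "y - 1 \<in> I \<or> y - 1 = x j" using that(2) by auto
      moreover have "x j \<in> ?X" "x (j + 1) \<in> ?X" using 3(1) by auto
      ultimately show ?thesis by auto
    qed
  qed
  have "?X \<subseteq> {x. st \<omega> x = Hole}"
  proof
    fix y assume "y \<in> ?X"
    then obtain j where j: "j \<in> {a..d}" "y = x j" by blast
    show "y \<in> {x. st \<omega> x = Hole}"
    proof (cases "j = d")
      case True
      then show ?thesis using right j by (simp add: right_confined_def)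
    next
      case False
      then show ?thesis using blocks[of j] j by (simp add: block_def)
    qed
  qed
  \<comment> \<open>Each piece is confined by one of the assumptions on half-lines and
    blocks.\<close>
  moreover have "\<forall>I\<in>?\<I>. confined \<omega> I"
    using left right blocks by (auto simp: right_confined_def block_def)
  ultimately have XH: "?X \<subseteq> H1 \<omega>"
    using H1_decompose[OF disj cover nb] by blast
  have "H1 \<omega> \<inter> ?I j = {}" if "j \<in> {a..<d}" for j
    using blocks[OF that] that
    by (intro H1_Int_finite[OF disj cover nb XH]) (auto simp: block_def)
  then have none: "y \<notin> ?I j" if "y \<in> H1 \<omega>" "j \<in> {a..<d}" for y j using that by blast
  show ?thesis
  proof (intro equalityI subsetI)
    fix y assume y: "y \<in> H1 \<omega> \<inter> {x a..x d}"
    show "y \<in> ?X"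
    proof (rule ccontr)
      assume "y \<notin> ?X"
      then have "y \<in> \<Union>?\<I>" unfolding cover by blast
      moreover have "y \<notin> {..<x a}" "y \<notin> {x d<..}" using y by auto
      ultimately obtain j where "j \<in> {a..<d}" "y \<in> ?I j" by blast
      then show False using none y by blast
    qed
  next
    fix y assume y: "y \<in> ?X"
    then show "y \<in> H1 \<omega> \<inter> {x a..x d}" using XH X[OF y] by auto
  qed
qed

text \<open>All pieces depend on disjoint sets of vertices. Translation brings each block to 0 and
  both half-lines to a common endpoint, where they recombine to the density.\<close>

lemma measure_blocks:
  assumes x: "strict_mono x" and ad: "a < (d::int)"
  shows "measure (golf_space rb rh p) {\<omega>. confined \<omega> {..<x a} \<and> right_confined \<omega> (x d) \<and>
      (\<forall>j\<in>{a..<d}. block \<omega> (x j) (x (j + 1)))} =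
    measure (golf_space rb rh p) {\<omega>. 0 \<in> H1 \<omega>} *
    (\<Prod>j\<in>{a..<d}. measure (golf_space rb rh p) {\<omega>. block \<omega> 0 (x (j + 1) - x j)})"
proof -
  note le = strict_mono_less_eq[OF x] and lt = strict_mono_less[OF x]
  let ?P = "measure (golf_space rb rh p)"
  \<comment> \<open>The index \<open>a - 1\<close> stands for the left half-line and
    \<open>d\<close> for the right one with its hole.\<close>
  define Q where "Q j \<omega> = (if j = a - 1 then confined \<omega> {..<x a} else if j = d then right_confined \<omega> (x d)
      else block \<omega> (x j) (x (j + 1)))" for j \<omega>
  \<comment> \<open>Half-open pieces: every prescribed hole belongs to exactly one of them, namely
    to the one on its right.\<close>
  define K where "K j = (if j = a - 1 then {..<x a} else if j = d then {x d..} else {x j..<x (j + 1)})" for j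
  have J: "{a - 1..d} = insert (a - 1) (insert d {a..<d})" using ad by auto
  have nQ: "Q j = (\<lambda>\<omega>. block \<omega> (x j) (x (j + 1)))" "K j = {x j..<x (j + 1)}" if "j \<in> {a..<d}" for j
    using that by (auto simp: Q_def K_def)
  have dQ: "Q d = (\<lambda>\<omega>. right_confined \<omega> (x d))" "K d = {x d..}" using ad by (auto simp: Q_def K_def)
  have aQ: "Q (a - 1) = (\<lambda>\<omega>. confined \<omega> {..<x a})" "K (a - 1) = {..<x a}" by (auto simp: Q_def K_def)
  have disj: "disjoint_family_on K {a - 1..d}"
  proof -
    have K: "K i \<inter> K j = {}" if "i \<in> {a - 1..d}" "j \<in> {a - 1..d}" "i < j" for i j
    proof -
      have i: "K i \<subseteq> {..<x (i + 1)}" using that by (auto simp: K_def)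
      have "K j \<subseteq> {x j..}" using that by (auto simp: K_def)
      moreover have "x (i + 1) \<le> x j" using that by (simp add: le)
      ultimately show ?thesis using i by force
    qed
    show ?thesis
      unfolding disjoint_family_on_def
    proof (intro ballI impI)
      fix i j assume "i \<in> {a - 1..d}" "j \<in> {a - 1..d}" "i \<noteq> j"
      then show "K i \<inter> K j = {}" using K[of i j] K[of j i] by (cases "i < j") auto
    qed
  qed
  have "{\<omega>. confined \<omega> {..<x a} \<and> right_confined \<omega> (x d) \<and> (\<forall>j\<in>{a..<d}. block \<omega> (x j) (x (j + 1)))}
      = {\<omega>. \<forall>j\<in>{a - 1..d}. Q j \<omega>}"
    unfolding J by (auto simp: aQ dQ nQ(1))
  also have "?P \<dots> = (\<Prod>j\<in>{a - 1..d}. ?P {\<omega>. Q j \<omega>})"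
  proof (rule golf_indep_blocks[OF _ _ disj])
    show "Measurable.pred (golf_space rb rh p) (Q j)" for j
      unfolding Q_def by measurable
    fix j and \<omega> \<omega>' :: "int \<Rightarrow> site"
    assume j: "j \<in> {a - 1..d}" and eq: "\<And>x. x \<in> K j \<Longrightarrow> \<omega> x = \<omega>' x"
    consider "j = a - 1" | "j = d" | "j \<in> {a..<d}" using j by force
    then show "Q j \<omega> = Q j \<omega>'"
    proof cases
      case 1
      then show ?thesis using eq aQ by (auto intro!: confined_cong)
    next
      case 2
      then show ?thesis using eq dQ by (auto intro!: right_confined_cong)
    next
      case 3
      then show ?thesis using eq nQ[OF 3] lt[of j "j + 1"] by (auto intro!: block_cong)
    qed
  qed (use ad in auto)
  also have "\<dots> = ?P {\<omega>. Q (a - 1) \<omega>} * (?P {\<omega>. Q d \<omega>} * (\<Prod>j\<in>{a..<d}. ?P {\<omega>. Q j \<omega>}))"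
    unfolding J using ad by simp
  also have "(\<Prod>j\<in>{a..<d}. ?P {\<omega>. Q j \<omega>}) = (\<Prod>j\<in>{a..<d}. ?P {\<omega>. block \<omega> 0 (x (j + 1) - x j)})"
  proof (rule prod.cong[OF refl])
    fix j assume "j \<in> {a..<d}"
    then show "?P {\<omega>. Q j \<omega>} = ?P {\<omega>. block \<omega> 0 (x (j + 1) - x j)}"
      using measure_block_shift[of rb rh p "x j" "x (j + 1) - x j"] by (simp add: nQ)
  qed
  finally show ?thesis
    unfolding aQ dQ measure_half_line_shift(1)[of rb rh p "x a"] measure_half_line_shift(2)[of rb rh p "x d"]
      measure_H1_density by simp
qed

text \<open>The positions of the free holes when the one of index 0 is at \<open>c\<close> and the
  gap of index \<open>i\<close> has length \<open>2 * b i\<close>.\<close>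

definition endpoint :: "(int \<Rightarrow> nat) \<Rightarrow> int \<Rightarrow> int \<Rightarrow> int" where
  "endpoint b c i = c + (if 0 \<le> i then \<Sum>j\<in>{0..<i}. 2 * int (b j) + 1 else - (\<Sum>j\<in>{i..<0}. 2 * int (b j) + 1))"

lemma endpoint_0 [simp]: "endpoint b c 0 = c"
  by (simp add: endpoint_def)

lemma endpoint_step: "endpoint b c (i + 1) = 2 * int (b i) + 1 + endpoint b c i"
proof (cases "0 \<le> i")
  case True
  then have "{0..<i + 1} = insert i {0..<i}" by auto
  then show ?thesis using True by (simp add: endpoint_def)
next
  case False
  then have "{i..<0} = insert i {i + 1..<0}" by auto
  then show ?thesis using False by (cases "i = - 1") (auto simp: endpoint_def)
qed

lemma strict_mono_endpoint: "strict_mono (endpoint b c)"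
proof (rule strict_monoI)
  fix i j :: int assume "i < j"
  then show "endpoint b c i < endpoint b c j"
    by (induction j rule: int_gr_induct) (auto simp: endpoint_step)
qed

theorem mainTheorem6:
  fixes rb rh p :: real and R :: nat and b :: "int \<Rightarrow> nat"
  assumes "0 \<le> rb" "rb + rh = 1" "rb < rh" "0 \<le> p" "p \<le> 1" "R > 0"
  shows "measure (golf_space rb rh p)
           {\<omega> \<in> space (golf_space rb rh p).
              \<forall>i\<in>{- int R..int R}. gap (H1 \<omega>) i = 2 * int (b i)}
         = (real (2 * b 0 + 1) * catalan (b 0) * (rb * rh) ^ b 0 / Hfun (rb * rh)) *
           (\<Prod>i\<in>{- int R..int R} - {0}. catalan (b i) * (rb * rh) ^ b i / Gfun (rb * rh))"
proof -
  interpret prob_space "golf_space rb rh p" by (rule prob_space_golf)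
  note rb = assms(1) and sum = assms(2) and less = assms(3)
  have rb1: "rb < 1" and rh: "0 < rh" using assms by auto
  let ?J = "{- int R..int R}" and ?l = "rb * rh"
  define T where "T b = {\<omega>. \<forall>i\<in>?J. gap (H1 \<omega>) i = 2 * int (b i)}" for b :: "int \<Rightarrow> nat"
  define g where "g i k = (if i = 0 then real (2 * k + 1) * catalan k * ?l ^ k / Hfun ?l
      else catalan k * ?l ^ k / Gfun ?l)" for i :: int and k
  have prod_g: "(\<Prod>i\<in>?J. g i (b i)) = real (2 * b 0 + 1) * catalan (b 0) * ?l ^ b 0 / Hfun ?l *
      (\<Prod>i\<in>?J - {0}. catalan (b i) * ?l ^ b i / Gfun ?l)" for b
    by (subst prod.remove[of _ 0]) (auto simp: g_def intro!: prod.cong)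
  have T: "T b \<in> events" for b
  proof -
    have "Measurable.pred (golf_space rb rh p) (\<lambda>\<omega>. \<forall>i\<in>?J. gap (H1 \<omega>) i = 2 * int (b i))" by measurable
    then show ?thesis by (simp add: pred_def T_def)
  qed
  have ge: "(\<Prod>i\<in>?J. g i (b i)) \<le> prob (T b)" for b
  proof -
    let ?x = "endpoint b" and ?a = "- int R" and ?d = "int R + 1"
    have J: "{?a..<?d} = ?J" by auto
    define E where "E c = {\<omega>. confined \<omega> {..<?x c ?a} \<and> right_confined \<omega> (?x c ?d) \<and>
      (\<forall>j\<in>{?a..<?d}. block \<omega> (?x c j) (?x c (j + 1)))}" for c
    have E: "E c \<in> events" for c
    proof -
      have "Measurable.pred (golf_space rb rh p) (\<lambda>\<omega>. confined \<omega> {..<?x c ?a} \<and> right_confined \<omega> (?x c ?d) \<and>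
        (\<forall>j\<in>{?a..<?d}. block \<omega> (?x c j) (?x c (j + 1))))" by measurable
      then show ?thesis by (simp add: pred_def E_def)
    qed
    \<comment> \<open>The admissible positions of the free hole of index 0: \<open>c \<le> 0\<close>
      and the next one, \<open>c + 2 * b 0 + 1\<close>, is positive. Their number is the
      size-biasing factor.\<close>
    let ?C = "{- 2 * int (b 0)..0}"
    have idx: "enum_idx (H1 \<omega>) i = ?x c i" if "\<omega> \<in> E c" "c \<in> ?C" "i \<in> {?a..?d}" for \<omega> c i
    proof (rule enum_idx_eq[OF strict_mono_endpoint])
      show "H1 \<omega> \<inter> {?x c ?a..?x c ?d} = ?x c ` {?a..?d}"
        by (rule H1_of_blocks[OF strict_mono_endpoint]) (use that(1) in \<open>auto simp: E_def\<close>)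
      show "?x c 0 \<le> 0" "0 < ?x c 1"
        using that(2) endpoint_step[of b c 0] by auto
    qed (use that(3) in auto)
    have sub: "E c \<subseteq> T b" if "c \<in> ?C" for c
    proof
      fix \<omega> assume \<omega>: "\<omega> \<in> E c"
      have "gap (H1 \<omega>) i = 2 * int (b i)" if i: "i \<in> ?J" for i
        using idx[OF \<omega> \<open>c \<in> ?C\<close>, of i] idx[OF \<omega> \<open>c \<in> ?C\<close>, of "i + 1"] i
        by (simp add: gap_def endpoint_step)
      then show "\<omega> \<in> T b" by (simp add: T_def)
    qed
    \<comment> \<open>The position of the free hole of index 0 is determined by the
      configuration.\<close>
    have disj: "disjoint_family_on E ?C"
      unfolding disjoint_family_on_def
    proof (intro ballI impI)
      fix c c' assume c: "c \<in> ?C" "c' \<in> ?C" "c \<noteq> c'"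
      show "E c \<inter> E c' = {}"
      proof (rule ccontr)
        assume "E c \<inter> E c' \<noteq> {}"
        then obtain \<omega> where "\<omega> \<in> E c" "\<omega> \<in> E c'" by blast
        then have "?x c 0 = ?x c' 0" using idx[of \<omega> c 0] idx[of \<omega> c' 0] c by simp
        then show False using c(3) by simp
      qed
    qed
    define q where "q = (rh - rb) * (\<Prod>j\<in>?J. catalan (b j) * ?l ^ b j * rh)"
    have q: "q \<le> prob (E c)" for c
    proof -
      have "prob (E c) = prob {\<omega>. 0 \<in> H1 \<omega>} * (\<Prod>j\<in>?J. prob {\<omega>. block \<omega> 0 (?x c (j + 1) - ?x c j)})"
        unfolding E_def by (subst measure_blocks[OF strict_mono_endpoint]) (auto simp: J)
      also have "\<dots> \<ge> q"
        unfolding q_def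
      proof (intro mult_mono prod_mono conjI)
        show "rh - rb \<le> prob {\<omega>. 0 \<in> H1 \<omega>}" by (rule H1_density_ge[OF rb rb1 sum])
        show "0 \<le> (\<Prod>j\<in>?J. catalan (b j) * ?l ^ b j * rh)"
          using rb rh by (intro prod_nonneg) (auto simp: catalan_def)
        show "catalan (b j) * ?l ^ b j * rh \<le> prob {\<omega>. block \<omega> 0 (?x c (j + 1) - ?x c j)}" for j
          using measure_block_ge[OF rb rb1 sum assms(4,5), of "b j"] by (simp add: endpoint_step)
      qed (use rb rh less in \<open>auto simp: catalan_def\<close>)
      finally show ?thesis .
    qed
    \<comment> \<open>The factor \<open>rh\<close> of each gap is \<open>1 / Gfun ?l\<close>, except
      that at index 0 it joins the density to give \<open>1 / Hfun ?l\<close>.\<close>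
    have "(\<Prod>i\<in>?J. g i (b i)) = real (2 * b 0 + 1) * q"
    proof -
      have "(\<Prod>j\<in>?J. catalan (b j) * ?l ^ b j * rh) = catalan (b 0) * ?l ^ b 0 * rh *
          (\<Prod>j\<in>?J - {0}. catalan (b j) * ?l ^ b j * rh)"
        by (rule prod.remove) auto
      then show ?thesis
        unfolding prod_g q_def Gfun_Hfun[OF rb sum less] by (simp add: ac_simps)
    qed
    also have "\<dots> = (\<Sum>c\<in>?C. q)" by simp
    also have "\<dots> \<le> (\<Sum>c\<in>?C. prob (E c))" by (intro sum_mono q)
    also have "\<dots> = prob (\<Union>c\<in>?C. E c)"
      by (rule finite_measure_finite_Union[symmetric]) (use E disj in auto)
    also have "\<dots> \<le> prob (T b)"
      by (rule finite_measure_mono[OF _ T]) (use sub in blast)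
    finally show ?thesis .
  qed
  \<comment> \<open>Families that agree on \<open>?J\<close> define the same event, so disjointness
    needs representatives that are fixed outside \<open>?J\<close>.\<close>
  define b' where "b' = restrict b ?J"
  have "prob (T b') = (\<Prod>i\<in>?J. g i (b' i))"
  proof (rule prob_eq_prod_of_ge[OF _ T _ ge])
    show "T b1 \<inter> T b2 = {}" if "b1 \<in> ?J \<rightarrow>\<^sub>E UNIV" "b2 \<in> ?J \<rightarrow>\<^sub>E UNIV" "b1 \<noteq> b2" for b1 b2
    proof (rule ccontr)
      assume "T b1 \<inter> T b2 \<noteq> {}"
      then have "\<forall>i\<in>?J. b1 i = b2 i" unfolding T_def by force
      then show False using that PiE_ext by blast
    qed
    show "g i sums 1" for i
    proof (cases "i = 0")
      case True
      then show ?thesis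
        using sums_divide[OF sums_catalan(2)[OF rb sum less], of "Hfun ?l"] less rh
        by (simp add: g_def[abs_def] Gfun_Hfun[OF rb sum less])
    next
      case False
      then show ?thesis
        using sums_divide[OF sums_catalan(1)[OF rb sum less], of "Gfun ?l"] rh
        by (simp add: g_def[abs_def] Gfun_Hfun[OF rb sum less])
    qed
  qed (auto simp: b'_def)
  moreover have "T b' = T b" by (auto simp: T_def b'_def)
  moreover have "(\<Prod>i\<in>?J. g i (b' i)) = (\<Prod>i\<in>?J. g i (b i))"
    by (intro prod.cong) (auto simp: b'_def)
  ultimately show ?thesis by (simp add: T_def prod_g)
qed

end
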